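(* Let $p$ be a prime and let $\{X_{n,k}:n\in\mathbb{N},\ k=1,\ldots,K_n\}$ be a rowwise independent array of random elements in the group $\Delta_p$ of $p$-adic integers. Suppose that there exists a Lévy measure $\eta$ on $\Delta_p$ such that (i) $\max_{1\le k\le K_n}\mathrm{P}\Bigl(\bigl((X_{n,k})_0,\ldots,(X_{n,k})_d\bigr)\neq 0\Bigr)\to0$ as $n\to\infty$ for all $d\in\mathbb{Z}_+$, (ii) $\sum_{k=1}^{K_n}\mathrm{P}\bigl((X_{n,k})_0=\ell_0,\ldots,(X_{n,k})_d=\ell_d\bigr)\to\eta(\{x\in\Delta_p:x_0=\ell_0,\ldots,x_d=\ell_d\})$ as $n\to\infty$ for all $d\in\mathbb{Z}_+$ and all $\ell_0,\ldots,\ell_d\in\{0,\ldots,p-1\}$ with $(\ell_0,\ldots,\ell_d)\neq0$. Then the array $\{X_{n,k}\}$ is infinitesimal, and the distribution of $\sum_{k=1}^{K_n}X_{n,k}$ converges weakly to $\pi_{\eta,\,g_{\Delta_p}}$ as $n\to\infty$.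
   Context: $\mathbb{N}$ and $\mathbb{Z}_+$ are the sets of positive and of nonnegative integers. $\Delta_p=\{(x_0,x_1,\ldots):x_j\in\{0,1,\ldots,p-1\}\text{ for all }j\in\mathbb{Z}_+\}$, where $z=x+y$ is determined by $\sum_{j=0}^d z_jp^j\equiv\sum_{j=0}^d(x_j+y_j)p^j \pmod{p^{d+1}}$ for all $d\in\mathbb{Z}_+$; its identity is $e=(0,0,\ldots)$. For $r\in\mathbb{Z}_+$ let $\Lambda_r=\{x\in\Delta_p:x_j=0\text{ for all }j\le r-1\}$; the topology of $\Delta_p$ is generated by the sets $x+\Lambda_r$, $x\in\Delta_p$, $r\in\mathbb{Z}_+$, and makes $\Delta_p$ a compact, totally disconnected Abelian group. Rowwise independent: for each $n$, $X_{n,1},\ldots,X_{n,K_n}$ are independent. Infinitesimal: $\lim_{n\to\infty}\max_{1\le k\le K_n}\mathrm{P}(X_{n,k}\in\Delta_p\setminus U)=0$ for every Borel set $U$ containing an open set that contains $e$. A Lévy measure on $\Delta_p$ is a $[0,\infty]$-valued Borel measure $\eta$ on $\Delta_p$ with $\eta(\{e\})=0$ and $\eta(\Delta_p\setminus\Lambda_r)<\infty$ for all $r\in\mathbb{Z}_+$. $g_{\Delta_p}$ is the function identically $0$ on $\Delta_p\times\widehat{\Delta}_p$, where $\widehat{\Delta}_p$ is the character group of $\Delta_p$, and $\pi_{\eta,\,g_{\Delta_p}}$ is the (existing, unique) probability measure on $\Delta_p$ with $\int_{\Delta_p}\chi\,d\pi_{\eta,\,g_{\Delta_p}}=\exp\left\{\int_{\Delta_p}(\chi(x)-1)\,d\eta(x)\right\}$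 for all $\chi\in\widehat{\Delta}_p$. The characters of $\Delta_p$ are $\chi_{d,\ell}(x)=e^{2\pi i\ell(x_0+px_1+\cdots+p^dx_d)/p^{d+1}}$, $d\in\mathbb{Z}_+$, $\ell=0,1,\ldots,p^{d+1}-1$. *)

theory Defs
  imports
    "HOL-Probability.Probability"
    "HOL-Algebra.Coset"
    "HOL-Algebra.FiniteProduct"
    "HOL-Number_Theory.Cong"
begin

section \<open>The topological group of $p$-adic integers\<close>

text \<open>The prime \<open>p\<close> is a term parameter, so the $p$-adic integers form a set of digit
  sequences rather than a type.\<close>

definition padic_set :: "nat \<Rightarrow> (nat \<Rightarrow> nat) set" where
  "padic_set p = {x. \<forall>j. x j \<in> {0..p - 1}}"

definition padic_add :: "nat \<Rightarrow> (nat \<Rightarrow> nat) \<Rightarrow> (nat \<Rightarrow> nat) \<Rightarrow> (nat \<Rightarrow> nat)" where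
  "padic_add p x y =
     (THE z. z \<in> padic_set p \<and>
        (\<forall>d. [(\<Sum>j\<le>d. z j * p ^ j) = (\<Sum>j\<le>d. (x j + y j) * p ^ j)] (mod p ^ (d + 1))))"

definition padic_zero :: "nat \<Rightarrow> nat" where
  "padic_zero = (\<lambda>_. 0)"

text \<open>HOL-Algebra groups are written multiplicatively: \<open>\<otimes>\<close>, \<open><#\<close> and \<open>\<Otimes>\<close> in this group are
  $p$-adic addition, translation and finite sum.\<close>

definition padic_group :: "nat \<Rightarrow> (nat \<Rightarrow> nat) monoid" where
  "padic_group p = \<lparr>carrier = padic_set p, monoid.mult = padic_add p, one = padic_zero\<rparr>"

definition padic_Lambda :: "nat \<Rightarrow> nat \<Rightarrow> (nat \<Rightarrow> nat) set" where
  "padic_Lambda p r = {x \<in> padic_set p. \<forall>j<r. x j = 0}"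

definition padic_topology :: "nat \<Rightarrow> (nat \<Rightarrow> nat) topology" where
  "padic_topology p = topology_generated_by
     {x <#\<^bsub>padic_group p\<^esub> padic_Lambda p r | x r. x \<in> padic_set p}"

definition padic_borel :: "nat \<Rightarrow> (nat \<Rightarrow> nat) measure" where
  "padic_borel p = sigma (padic_set p) {U. openin (padic_topology p) U}"

definition padic_character :: "nat \<Rightarrow> ((nat \<Rightarrow> nat) \<Rightarrow> complex) \<Rightarrow> bool" where
  "padic_character p \<psi> \<longleftrightarrow>
     continuous_map (padic_topology p) euclidean \<psi> \<and>
     (\<forall>x\<in>padic_set p. norm (\<psi> x) = 1) \<and>
     (\<forall>x\<in>padic_set p. \<forall>y\<in>padic_set p. \<psi> (x \<otimes>\<^bsub>padic_group p\<^esub> y) = \<psi> x * \<psi> y)"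

section \<open>Measures and arrays\<close>

definition padic_levy_measure :: "nat \<Rightarrow> (nat \<Rightarrow> nat) measure \<Rightarrow> bool" where
  "padic_levy_measure p \<eta> \<longleftrightarrow>
     sets \<eta> = sets (padic_borel p) \<and>
     emeasure \<eta> {padic_zero} = 0 \<and>
     (\<forall>r. emeasure \<eta> (padic_set p - padic_Lambda p r) < \<infinity>)"

text \<open>The measure $\pi_{\eta,g}$ for the local inner product $g = 0$; the usual term
  $-i g(x,\chi)$ in the exponent is therefore absent.\<close>

definition padic_pi :: "nat \<Rightarrow> (nat \<Rightarrow> nat) measure \<Rightarrow> (nat \<Rightarrow> nat) measure" where
  "padic_pi p \<eta> =
     (THE \<pi>. prob_space \<pi> \<and> sets \<pi> = sets (padic_borel p) \<and>
        (\<forall>\<psi>. padic_character p \<psi> \<longrightarrow>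
           (\<integral>x. \<psi> x \<partial>\<pi>) = exp (\<integral>x. (\<psi> x - 1) \<partial>\<eta>)))"

definition weakly_converges ::
    "'a topology \<Rightarrow> (nat \<Rightarrow> 'a measure) \<Rightarrow> 'a measure \<Rightarrow> bool" where
  "weakly_converges T \<mu> \<nu> \<longleftrightarrow>
     (\<forall>f :: 'a \<Rightarrow> real. continuous_map T euclidean f \<and> bounded (f ` topspace T) \<longrightarrow>
        (\<lambda>n. \<integral>x. f x \<partial>(\<mu> n)) \<longlonglongrightarrow> (\<integral>x. f x \<partial>\<nu>))"

text \<open>Row \<open>n\<close> lives on its own probability space \<open>M n\<close>.\<close>

definition padic_infinitesimal ::
    "nat \<Rightarrow> (nat \<Rightarrow> 'a measure) \<Rightarrow> (nat \<Rightarrow> nat) \<Rightarrow> (nat \<Rightarrow> nat \<Rightarrow> 'a \<Rightarrow> (nat \<Rightarrow> nat)) \<Rightarrow> bool" where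
  "padic_infinitesimal p M K X \<longleftrightarrow>
     (\<forall>U \<in> sets (padic_borel p).
        (\<exists>V. openin (padic_topology p) V \<and> padic_zero \<in> V \<and> V \<subseteq> U) \<longrightarrow>
        (\<lambda>n. MAX k\<in>{1..K n}. measure (M n) {\<omega> \<in> space (M n). X n k \<omega> \<in> padic_set p - U})
          \<longlonglongrightarrow> 0)"

end

(* Modulo p^r the row sums take finitely many values, so weak convergence on the p-adic integers is
   convergence of the probabilities of all cylinders. By Fourier inversion on Z/p^r these are finite
   linear combinations of integrals of characters, and a compatible family of limits is a measure by
   Kolmogorov's extension theorem; thus pointwise convergence of the character integrals suffices,
   and it also produces the limit. Every character psi factors through some Z/p^r, so hypothesis (ii)
   gives convergence of the sums over k of E psi(X_{n,k}) - 1 to the integral of psi - 1 against eta;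
   by hypothesis (i) each term is small, so the product of the E psi(X_{n,k}) converges to the
   exponential. *)

theory Submission
  imports Defs
begin

section \<open>Residues, topology and Borel sets of the $p$-adic integers\<close>

text \<open>Addition and \<open>padic_pi\<close> are definite descriptions, so each needs existence
  and uniqueness before anything can be computed with it. A sum is found by prescribing its residues
  and lifting them to digits. For \<open>padic_pi\<close>, uniqueness comes from the same inversion
  formula that yields the limit.

  The measure \<eta> may have infinite mass near the identity. Only \<psi> - 1 is integrated against
  it, and this vanishes on some \<open>padic_Lambda p r\<close>. What remains is a finite sum over
  nonzero residue classes, each of finite mass, and these are exactly the classes that hypothesis
  (ii) speaks of.

  The passage from the product to the exponential rests on a quadratic error: replacing each factor
  1 + c by exp c costs at most a constant times max |c| times the sum of |c|. The maximum tends to 0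
  by (i), and the sum stays bounded by (ii).\<close>

definition padic_val :: "nat \<Rightarrow> nat \<Rightarrow> (nat \<Rightarrow> nat) \<Rightarrow> nat" where
  "padic_val p r x = (\<Sum>j<r. x j * p ^ j)"

text \<open>For \<open>a < p ^ r\<close> this is a coset of \<open>padic_Lambda p r\<close>, for
  larger \<open>a\<close> it is empty. Since \<open>r\<close> counts digits, conditions on the
  digits 0, ..., d are conditions at level \<open>Suc d\<close>.\<close>

definition padic_cyl :: "nat \<Rightarrow> nat \<Rightarrow> nat \<Rightarrow> (nat \<Rightarrow> nat) set" where
  "padic_cyl p r a = {x \<in> padic_set p. padic_val p r x = a}"

text \<open>The image of the natural number \<open>m\<close> in the p-adic integers. It serves as a
  representative of the residue class of \<open>m\<close> at every level.\<close>

definition padic_digits :: "nat \<Rightarrow> nat \<Rightarrow> nat \<Rightarrow> nat" where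
  "padic_digits p m j = m div p ^ j mod p"

text \<open>The \<open>p\<close>-adic integer that is congruent to \<open>a r\<close> modulo \<open>p ^ r\<close> for every \<open>r\<close>, provided that
  the residues \<open>a r\<close> are compatible.\<close>

definition padic_of_residues :: "nat \<Rightarrow> (nat \<Rightarrow> nat) \<Rightarrow> nat \<Rightarrow> nat" where
  "padic_of_residues p a j = a (Suc j) div p ^ j mod p"

text \<open>Residues are measured in the discrete sigma-algebra, finite sums of them in the Borel
  one; this passes between the two.\<close>

lemma measurable_borel_nat_iff:
  "f \<in> measurable M (borel :: nat measure) \<longleftrightarrow> f \<in> measurable M (count_space UNIV)"
  using measurable_cong_sets[OF refl sets_borel_eq_count_space[where ?'a = nat]] by blast

locale padic =
  fixes p :: nat
  assumes p_pos: "0 < p"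
begin

abbreviation "\<Delta> \<equiv> padic_set p"
abbreviation "V \<equiv> padic_val p"
abbreviation "C \<equiv> padic_cyl p"
abbreviation "G \<equiv> padic_group p"
abbreviation "T \<equiv> padic_topology p"
abbreviation "B \<equiv> padic_borel p"

section \<open>Arithmetic of residues modulo powers of p\<close>

lemma padic_set_iff: "x \<in> \<Delta> \<longleftrightarrow> (\<forall>j. x j < p)"
proof -
  have "n \<in> {0..p - 1} \<longleftrightarrow> n < p" for n using p_pos by auto
  then show ?thesis by (simp add: padic_set_def)
qed

lemma val_0 [simp]: "V 0 x = 0"
  by (simp add: padic_val_def)

lemma val_Suc: "V (Suc r) x = V r x + x r * p ^ r"
  by (simp add: padic_val_def)

lemma val_less: "x \<in> \<Delta> \<Longrightarrow> V r x < p ^ r"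
proof (induction r)
  case (Suc r)
  have "V (Suc r) x < p ^ r + x r * p ^ r"
    using Suc by (simp add: val_Suc)
  also have "\<dots> = Suc (x r) * p ^ r" by simp
  also have "\<dots> \<le> p * p ^ r"
    using Suc.prems by (intro mult_right_mono) (auto simp: padic_set_iff Suc_le_eq)
  finally show ?case by simp
qed auto

lemma val_mod: 
  assumes "x \<in> \<Delta>" "r \<le> s" shows "V s x mod p ^ r = V r x"
  using assms(2)
proof (induction s rule: dec_induct)
  case base
  then show ?case using val_less[OF assms(1)] by simp
next
  case (step s)
  have "p ^ r dvd x s * p ^ s"
    using step.hyps by (simp add: le_imp_power_dvd)
  then have "V (Suc s) x mod p ^ r = V s x mod p ^ r"
    by (simp add: val_Suc mod_add_eq[symmetric])
  then show ?case using step by simp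
qed

lemma val_eq_iff:
  assumes "x \<in> \<Delta>" "y \<in> \<Delta>"
  shows "V r x = V r y \<longleftrightarrow> (\<forall>j<r. x j = y j)"
proof (induction r)
  case (Suc r)
  have "x r = y r \<and> V r x = V r y" if "V (Suc r) x = V (Suc r) y"
  proof -
    from that have *: "V r x = V r y"
      using val_mod[OF assms(1), of r "Suc r"] val_mod[OF assms(2), of r "Suc r"] by simp
    then show ?thesis using that p_pos by (simp add: val_Suc)
  qed
  then show ?case using Suc by (auto simp: val_Suc less_Suc_eq)
qed auto

lemma padic_eqI:
  assumes "x \<in> \<Delta>" "y \<in> \<Delta>" "\<And>r. V r x = V r y"
  shows "x = y"
  using assms(3)[of "Suc _"] val_eq_iff[OF assms(1,2)] by (metis ext lessI)

lemma zero_in_padic_set [simp]: "padic_zero \<in> \<Delta>"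
  using p_pos by (simp add: padic_zero_def padic_set_iff)

lemma val_zero [simp]: "V r padic_zero = 0"
  by (simp add: padic_val_def padic_zero_def)

lemma of_residues_in [simp]: "padic_of_residues p a \<in> \<Delta>"
  using p_pos by (simp add: padic_set_iff padic_of_residues_def)

text \<open>Splitting \<open>a (Suc r)\<close> modulo \<open>p ^ r * p\<close> gives the new digit
  plus the residue modulo \<open>p ^ r\<close>, which compatibility identifies with that of
  \<open>a r\<close>. The family need not be reduced, so sums and differences of residues can be
  inserted directly.\<close>

lemma val_of_residues:
  assumes "\<And>r. a (Suc r) mod p ^ r = a r mod p ^ r"
  shows "V r (padic_of_residues p a) = a r mod p ^ r"
proof (induction r)
  case (Suc r)
  have "a (Suc r) mod (p ^ r * p) = p ^ r * (a (Suc r) div p ^ r mod p) + a (Suc r) mod p ^ r"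
    by (rule mod_mult2_eq)
  then show ?case
    using Suc assms[of r] by (simp add: val_Suc padic_of_residues_def mult.commute)
qed auto

lemma digits_in [simp]: "padic_digits p m \<in> \<Delta>"
  using p_pos by (simp add: padic_set_iff padic_digits_def)

lemma val_digits: "V r (padic_digits p m) = m mod p ^ r"
  using val_of_residues[of "\<lambda>_. m" r]
  by (simp add: padic_of_residues_def padic_digits_def[abs_def] padic_of_residues_def[abs_def])

lemma digits_mod: "j < r \<Longrightarrow> padic_digits p (m mod p ^ r) j = padic_digits p m j"
  using val_eq_iff[OF digits_in digits_in, of r "m mod p ^ r" m] by (simp add: val_digits)

section \<open>The group structure\<close>

lemma padic_add:
  assumes "x \<in> \<Delta>" "y \<in> \<Delta>"
  shows padic_add_in: "padic_add p x y \<in> \<Delta>"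
    and val_padic_add: "V r (padic_add p x y) = (V r x + V r y) mod p ^ r"
proof -
  define Q where "Q z \<longleftrightarrow> z \<in> \<Delta> \<and>
    (\<forall>d. [(\<Sum>j\<le>d. z j * p ^ j) = (\<Sum>j\<le>d. (x j + y j) * p ^ j)] (mod p ^ (d + 1)))" for z
  have Q: "Q z \<longleftrightarrow> z \<in> \<Delta> \<and> (\<forall>r. V r z = (V r x + V r y) mod p ^ r)" for z
  proof -
    have "[(\<Sum>j\<le>d. z j * p ^ j) = (\<Sum>j\<le>d. (x j + y j) * p ^ j)] (mod p ^ (d + 1))
        \<longleftrightarrow> V (Suc d) z = (V (Suc d) x + V (Suc d) y) mod p ^ Suc d" if "z \<in> \<Delta>" for d
      using val_less[OF that, of "Suc d"]
      by (simp add: padic_val_def cong_def lessThan_Suc_atMost distrib_right sum.distrib)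
    \<comment> \<open>The definition speaks of the levels \<open>Suc d\<close> only; level 0 adds
      nothing because everything is congruent modulo 1.\<close>
    moreover have "(\<forall>d. V (Suc d) z = (V (Suc d) x + V (Suc d) y) mod p ^ Suc d)
        \<longleftrightarrow> (\<forall>r. V r z = (V r x + V r y) mod p ^ r)" (is "(\<forall>d. ?R (Suc d)) \<longleftrightarrow> (\<forall>r. ?R r)")
    proof
      assume *: "\<forall>d. ?R (Suc d)"
      show "\<forall>r. ?R r"
      proof
        show "?R r" for r using * by (cases r) auto
      qed
    qed blast
    ultimately show ?thesis
      unfolding Q_def by blast
  qed
  \<comment> \<open>Existence: the unreduced sums of residues form a compatible family, so they lift
    to a digit sequence. Uniqueness is \<open>padic_eqI\<close>.\<close>
  define z where "z = padic_of_residues p (\<lambda>r. V r x + V r y)"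
  have "(V (Suc r) x + V (Suc r) y) mod p ^ r = (V r x + V r y) mod p ^ r" for r
    by (subst mod_add_eq[symmetric]) (simp add: val_mod assms)
  then have z: "Q z"
    unfolding Q z_def using val_of_residues[of "\<lambda>r. V r x + V r y"] by simp
  have "padic_add p x y = (THE z. Q z)"
    unfolding padic_add_def Q_def ..
  also have "\<dots> = z"
    using z by (intro the_equality) (auto simp: Q intro: padic_eqI)
  finally show "padic_add p x y \<in> \<Delta>" "V r (padic_add p x y) = (V r x + V r y) mod p ^ r"
    using z by (auto simp: Q)
qed

lemma group_simps [simp]:
  "carrier G = \<Delta>" "x \<otimes>\<^bsub>G\<^esub> y = padic_add p x y" "\<one>\<^bsub>G\<^esub> = padic_zero"
  by (simp_all add: padic_group_def)

lemma ex_inverse: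
  assumes "x \<in> \<Delta>" shows "\<exists>y\<in>\<Delta>. padic_add p y x = padic_zero"
proof -
  \<comment> \<open>The residues of -x. The entry is \<open>p ^ r\<close> itself when
    \<open>V r x = 0\<close>, which is harmless since residues are reduced on lifting.\<close>
  define y where "y = padic_of_residues p (\<lambda>r. p ^ r - V r x)"
  have *: "(p ^ Suc r - V (Suc r) x) mod p ^ r = (p ^ r - V r x) mod p ^ r" for r
  proof -
    \<comment> \<open>Both sides are powers of \<open>p\<close> that vanish modulo
      \<open>p ^ r\<close>; cancelling the residue of \<open>x\<close> then gives
      compatibility.\<close>
    have "[p ^ Suc r - V (Suc r) x + V (Suc r) x = p ^ r - V r x + V r x] (mod p ^ r)"
      using val_less[OF assms, of r] val_less[OF assms, of "Suc r"] by (simp add: cong_def)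
    moreover have "[V (Suc r) x = V r x] (mod p ^ r)"
      using val_mod[OF assms, of r "Suc r"] val_less[OF assms, of r] by (simp add: cong_def)
    ultimately have "[p ^ Suc r - V (Suc r) x + V r x = p ^ r - V r x + V r x] (mod p ^ r)"
      by (blast intro: cong_add cong_trans cong_sym cong_refl)
    then show ?thesis
      by (simp only: cong_add_rcancel_nat cong_def[symmetric])
  qed
  have y: "y \<in> \<Delta>" by (simp add: y_def)
  have "V r (padic_add p y x) = 0" for r
    unfolding val_padic_add[OF y assms] unfolding y_def val_of_residues[OF *]
    using val_less[OF assms, of r] by (simp add: mod_add_left_eq)
  then show ?thesis
    using y assms by (intro bexI[of _ y] padic_eqI) (auto simp: padic_add_in)
qed

lemma comm_group_padic: "comm_group G"
proof (rule comm_groupI; simp add: padic_add_in ex_inverse)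
  fix x y assume *: "x \<in> \<Delta>" "y \<in> \<Delta>"
  show "padic_add p x y = padic_add p y x"
    using * by (intro padic_eqI) (auto simp: padic_add_in val_padic_add add.commute)
  fix z assume "z \<in> \<Delta>"
  then show "padic_add p (padic_add p x y) z = padic_add p x (padic_add p y z)"
    using * by (intro padic_eqI) (auto simp: padic_add_in val_padic_add mod_add_left_eq mod_add_right_eq add.assoc)
next
  fix x assume "x \<in> \<Delta>"
  then show "padic_add p padic_zero x = x"
    by (intro padic_eqI) (auto simp: padic_add_in val_padic_add val_less)
qed

sublocale G: comm_group G
  by (rule comm_group_padic)

lemma val_finprod:
  assumes "finite I" "\<And>i. i \<in> I \<Longrightarrow> x i \<in> \<Delta>"
  shows "V r (\<Otimes>\<^bsub>G\<^esub>i\<in>I. x i) = (\<Sum>i\<in>I. V r (x i)) mod p ^ r"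
  using assms
proof (induction I rule: finite_induct)
  case (insert i I)
  then have "x \<in> I \<rightarrow> carrier G" "x i \<in> carrier G" "(\<Otimes>\<^bsub>G\<^esub>i\<in>I. x i) \<in> \<Delta>"
    using G.finprod_closed[of x I] by auto
  then show ?case
    using insert by (simp add: G.finprod_insert val_padic_add mod_add_right_eq)
qed auto

section \<open>Cylinders and the topology\<close>

lemma Lambda_eq_cyl: "padic_Lambda p r = C r 0"
proof -
  have "V r x = 0 \<longleftrightarrow> (\<forall>j<r. x j = 0)" if "x \<in> \<Delta>" for x
    using val_eq_iff[OF that zero_in_padic_set, of r] val_zero[of r] by (simp add: padic_zero_def)
  then show ?thesis
    unfolding padic_Lambda_def padic_cyl_def by (intro Collect_cong conj_cong refl) simp
qed

lemma coset_eq_cyl: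
  assumes "x \<in> \<Delta>" shows "x <#\<^bsub>G\<^esub> padic_Lambda p r = C r (V r x)"
proof (intro Set.set_eqI iffI)
  fix y assume "y \<in> x <#\<^bsub>G\<^esub> padic_Lambda p r"
  then show "y \<in> C r (V r x)"
    using assms val_less[OF assms, of r]
    by (auto simp: l_coset_def Lambda_eq_cyl padic_cyl_def padic_add_in val_padic_add)
next
  fix y assume y: "y \<in> C r (V r x)"
  then have "y \<in> \<Delta>" by (simp add: padic_cyl_def)
  obtain x' where x': "x' \<in> \<Delta>" "padic_add p x' x = padic_zero"
    using ex_inverse[OF assms] by auto
  \<comment> \<open>\<open>h\<close> is y - x; equal residues of \<open>x\<close> and
    \<open>y\<close> put it into the subgroup.\<close>
  define h where "h = padic_add p x' y"
  have h: "h \<in> \<Delta>" "padic_add p x h = y"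
    using x' assms \<open>y \<in> \<Delta>\<close> G.m_assoc[of x x' y] G.m_comm[of x x'] G.l_one[of y]
    by (auto simp: h_def padic_add_in)
  have "V r h = (V r x' + V r x) mod p ^ r"
    using y x' by (simp add: h_def val_padic_add padic_cyl_def)
  also have "\<dots> = 0"
    using val_padic_add[OF x'(1) assms, of r] x'(2) by simp
  finally have "h \<in> padic_Lambda p r"
    using h x' by (simp add: Lambda_eq_cyl padic_cyl_def)
  then show "y \<in> x <#\<^bsub>G\<^esub> padic_Lambda p r"
    using h(2) by (auto simp: l_coset_def)
qed

lemma cyl_subset: "C r a \<subseteq> \<Delta>"
  by (auto simp: padic_cyl_def)

lemma cyl_mono:
  assumes "x \<in> \<Delta>" "r \<le> s" shows "C s (V s x) \<subseteq> C r (V r x)"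
proof
  fix y assume "y \<in> C s (V s x)"
  then have "y \<in> \<Delta>" "V s y = V s x" by (auto simp: padic_cyl_def)
  then show "y \<in> C r (V r x)"
    using val_mod[OF assms] val_mod[OF _ assms(2), of y] by (simp add: padic_cyl_def)
qed

lemma in_cyl_val [simp]: "x \<in> C r (V r x) \<longleftrightarrow> x \<in> \<Delta>"
  by (auto simp: padic_cyl_def)

text \<open>The ultrametric property: two cylinders are disjoint or nested. It makes the cylinders,
  together with the empty set, a generator stable under intersection.\<close>

lemma cyl_Int: "C r a \<inter> C s b \<in> {{}, C r a, C s b}"
proof (cases "C r a \<inter> C s b = {}")
  case False
  then obtain x where "x \<in> C r a" "x \<in> C s b" by auto
  then have "x \<in> \<Delta>" "a = V r x" "b = V s x" by (auto simp: padic_cyl_def)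
  then show ?thesis
    using cyl_mono[of x r s] cyl_mono[of x s r] linear[of r s] by auto
qed auto

lemma ex_digit_nonzero_iff: "x \<in> \<Delta> \<Longrightarrow> (\<exists>j\<le>d. x j \<noteq> 0) \<longleftrightarrow> x \<notin> C (Suc d) 0"
  using val_eq_iff[OF _ zero_in_padic_set, of x "Suc d"]
  by (auto simp: padic_cyl_def padic_zero_def[THEN fun_cong] less_Suc_eq_le)

lemma digits_eq_iff:
  "x \<in> \<Delta> \<Longrightarrow> a < p ^ Suc d \<Longrightarrow> (\<forall>j\<le>d. x j = padic_digits p a j) \<longleftrightarrow> x \<in> C (Suc d) a"
  using val_eq_iff[OF _ digits_in, of x "Suc d" a]
  by (auto simp: padic_cyl_def val_digits less_Suc_eq_le)

lemma openin_padic_iff: "openin T U \<longleftrightarrow> U \<subseteq> \<Delta> \<and> (\<forall>x\<in>U. \<exists>r. C r (V r x) \<subseteq> U)"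
proof -
  let ?S = "{x <#\<^bsub>G\<^esub> padic_Lambda p r | x r. x \<in> \<Delta>}"
  have S: "?S = {C r (V r x) | x r. x \<in> \<Delta>}"
    using coset_eq_cyl by (metis (no_types, lifting))
  have "U \<subseteq> \<Delta> \<and> (\<forall>x\<in>U. \<exists>r. C r (V r x) \<subseteq> U)" if "generate_topology_on ?S U"
    using that
  proof induction
    case (Int a b)
    show ?case
    proof (intro conjI ballI)
      fix x assume x: "x \<in> a \<inter> b"
      then obtain r s where "C r (V r x) \<subseteq> a" "C s (V s x) \<subseteq> b" "x \<in> \<Delta>" using Int by blast
      then have "C (max r s) (V (max r s) x) \<subseteq> a \<inter> b"
        using cyl_mono[of x r "max r s"] cyl_mono[of x s "max r s"] by auto
      then show "\<exists>r. C r (V r x) \<subseteq> a \<inter> b" by blast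
    qed (use Int in auto)
  next
    case (UN K)
    then show ?case by (meson Sup_least Union_iff Union_upper subset_trans)
  next
    case (Basis s)
    then obtain x r where "x \<in> \<Delta>" "s = C r (V r x)" unfolding S by blast
    \<comment> \<open>Each point of a cylinder is a centre of it: the cylinder of the same level
      around \<open>y\<close> is \<open>s\<close> again.\<close>
    moreover have "\<forall>y\<in>s. C r (V r y) \<subseteq> s"
      using \<open>s = _\<close> by (auto simp: padic_cyl_def)
    ultimately show ?case using cyl_subset by blast
  qed auto
  moreover have "generate_topology_on ?S U" if U: "U \<subseteq> \<Delta>" "\<forall>x\<in>U. \<exists>r. C r (V r x) \<subseteq> U"
  proof -
    have "U = \<Union>{A \<in> ?S. A \<subseteq> U}"
    proof (intro subset_antisym subsetI)
      fix x assume "x \<in> U"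
      then obtain r where r: "C r (V r x) \<subseteq> U" "x \<in> \<Delta>" using U by blast
      moreover have "C r (V r x) \<in> ?S" unfolding S using r(2) by blast
      ultimately show "x \<in> \<Union>{A \<in> ?S. A \<subseteq> U}"
        by (intro UnionI[of "C r (V r x)"]) auto
    qed auto
    moreover have "generate_topology_on ?S (\<Union>{A \<in> ?S. A \<subseteq> U})"
      by (intro generate_topology_on.UN) (auto intro: generate_topology_on.Basis)
    ultimately show ?thesis by simp
  qed
  ultimately show ?thesis
    unfolding padic_topology_def openin_topology_generated_by_iff by blast
qed

lemma topspace_padic [simp]: "topspace T = \<Delta>"
proof -
  have "openin T \<Delta>" by (auto simp: openin_padic_iff padic_cyl_def)
  then show ?thesis
    by (metis openin_padic_iff openin_subset openin_topspace subset_antisym)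
qed

lemma openin_cyl: "openin T (C r a)"
  by (auto simp: openin_padic_iff padic_cyl_def)

lemma open_eq_Union_cyl:
  assumes "openin T U"
  shows "U = (\<Union>(r, a) \<in> {(r, a). C r a \<subseteq> U}. C r a)"
proof (intro subset_antisym subsetI)
  fix x assume "x \<in> U"
  then obtain r where "C r (V r x) \<subseteq> U" "x \<in> \<Delta>" using assms openin_padic_iff by blast
  then show "x \<in> (\<Union>(r, a) \<in> {(r, a). C r a \<subseteq> U}. C r a)" 
    by (intro UN_I[of "(r, V r x)"]) auto
qed auto

section \<open>Borel sets and measurability\<close>

lemma padic_space [simp]: "space B = \<Delta>"
  by (simp add: padic_borel_def space_measure_of_conv)

lemma sets_padic_borel: "sets B = sigma_sets \<Delta> {U. openin T U}"
  unfolding padic_borel_def by (intro sets_measure_of) (auto simp: openin_padic_iff)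

lemma open_sets [measurable]: "openin T U \<Longrightarrow> U \<in> sets B"
  by (auto simp: sets_padic_borel)

lemma cyl_sets [measurable]: "C r a \<in> sets B"
  by (intro open_sets openin_cyl)

text \<open>Cylinders are indexed by pairs of natural numbers, so every open set is a countable
  union of them.\<close>

lemma sets_padic_borel_cyl: "sets B = sigma_sets \<Delta> (insert {} (range (\<lambda>(r, a). C r a)))"
proof (rule subset_antisym)
  have "U \<in> sigma_sets \<Delta> (insert {} (range (\<lambda>(r, a). C r a)))" if "openin T U" for U
  proof -
    have sa: "sigma_algebra \<Delta> (sigma_sets \<Delta> (insert {} (range (\<lambda>(r, a). C r a))))"
      by (intro sigma_algebra_sigma_sets) (use cyl_subset in auto)
    have "(\<Union>(r, a) \<in> {(r, a). C r a \<subseteq> U}. C r a) \<in> sigma_sets \<Delta> (insert {} (range (\<lambda>(r, a). C r a)))"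
      by (intro sigma_algebra.countable_UN'[OF sa]) auto
    then show ?thesis using open_eq_Union_cyl[OF that] by simp
  qed
  then show "sets B \<subseteq> sigma_sets \<Delta> (insert {} (range (\<lambda>(r, a). C r a)))"
    unfolding sets_padic_borel by (intro sigma_sets_mono) auto
  show "sigma_sets \<Delta> (insert {} (range (\<lambda>(r, a). C r a))) \<subseteq> sets B"
    unfolding sets_padic_borel using openin_cyl by (intro sigma_sets_mono') auto
qed

lemma measurable_padicI:
  assumes "\<And>\<omega>. \<omega> \<in> space M \<Longrightarrow> f \<omega> \<in> \<Delta>"
    and "\<And>r. (\<lambda>\<omega>. V r (f \<omega>)) \<in> measurable M (count_space UNIV)"
  shows "f \<in> measurable M B"
proof -
  have "f -` C r a \<inter> space M \<in> sets M" for r a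
  proof -
    have "f -` C r a \<inter> space M = (\<lambda>\<omega>. V r (f \<omega>)) -` {a} \<inter> space M"
      using assms(1) by (auto simp: padic_cyl_def)
    also have "\<dots> \<in> sets M"
      by (rule measurable_sets[OF assms(2)]) auto
    finally show ?thesis .
  qed
  then show ?thesis
    using assms(1) cyl_subset[THEN subsetD]
    by (intro measurable_sigma_sets[OF sets_padic_borel_cyl]) auto
qed

lemma val_measurable [measurable]: "V r \<in> measurable B (count_space UNIV)"
proof (rule measurable_count_space_eq2_countable[THEN iffD2], intro conjI ballI)
  fix a
  have "V r -` {a} \<inter> space B = C r a" by (auto simp: padic_cyl_def)
  then show "V r -` {a} \<inter> space B \<in> sets B" by simp
qed auto

text \<open>Joint measurability of addition is avoided: modulo \<open>p ^ r\<close> the sum is an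
  ordinary sum of natural-valued functions, and measurability may be tested on residues.\<close>

lemma finprod_measurable:
  assumes "finite I" "\<And>i. i \<in> I \<Longrightarrow> X i \<in> measurable M B"
  shows "(\<lambda>\<omega>. \<Otimes>\<^bsub>G\<^esub>i\<in>I. X i \<omega>) \<in> measurable M B"
proof (rule measurable_padicI)
  have X: "X i \<omega> \<in> \<Delta>" if "i \<in> I" "\<omega> \<in> space M" for i \<omega>
    using measurable_space[OF assms(2)[OF that(1)] that(2)] by simp
  then show "(\<Otimes>\<^bsub>G\<^esub>i\<in>I. X i \<omega>) \<in> \<Delta>" if "\<omega> \<in> space M" for \<omega>
    using G.finprod_closed[of "\<lambda>i. X i \<omega>" I] that by auto
  fix r
  have "(\<lambda>\<omega>. \<Sum>i\<in>I. V r (X i \<omega>)) \<in> measurable M (borel :: nat measure)"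
    using measurable_compose[OF assms(2) val_measurable]
    unfolding measurable_borel_nat_iff[symmetric] by (intro borel_measurable_sum)
  then have "(\<lambda>\<omega>. \<Sum>i\<in>I. V r (X i \<omega>)) \<in> measurable M (count_space UNIV)"
    by (simp only: measurable_borel_nat_iff)
  then have "(\<lambda>\<omega>. (\<Sum>i\<in>I. V r (X i \<omega>)) mod p ^ r) \<in> measurable M (count_space UNIV)"
    by measurable
  then show "(\<lambda>\<omega>. V r (\<Otimes>\<^bsub>G\<^esub>i\<in>I. X i \<omega>)) \<in> measurable M (count_space UNIV)"
    by (subst measurable_cong) (auto intro!: val_finprod assms X)
qed

end

section \<open>Fourier inversion and existence of measures\<close>

lemma power_mod_eq:
  fixes z :: "'a::monoid_mult"
  assumes "z ^ N = 1" shows "z ^ (m mod N) = z ^ m"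
proof -
  have "z ^ m = z ^ (N * (m div N) + m mod N)" by (simp only: mult_div_mod_eq)
  also have "\<dots> = z ^ (m mod N)" by (simp only: power_add power_mult assms power_one mult_1)
  finally show ?thesis ..
qed

context padic
begin

section \<open>Characters of the finite quotients\<close>

definition zeta :: "nat \<Rightarrow> complex" where
  "zeta r = cis (2 * pi / real (p ^ r))"

definition chi :: "nat \<Rightarrow> nat \<Rightarrow> (nat \<Rightarrow> nat) \<Rightarrow> complex" where
  "chi r l x = zeta r ^ (l * V r x)"

lemma zeta_power_eq: "zeta r ^ k = cis (2 * pi * real k / real (p ^ r))"
  unfolding zeta_def Complex.DeMoivre by (simp add: field_simps)

lemma zeta_power: "zeta r ^ p ^ r = 1"
  using p_pos by (simp add: zeta_power_eq)

lemma zeta_inj: "inj_on (\<lambda>k. zeta r ^ k) {..<p ^ r}"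
  unfolding zeta_power_eq
  using bij_betw_imp_inj_on[OF Complex.bij_betw_roots_unity[of "p ^ r"]] p_pos by simp

lemma zeta_nonzero [simp]: "zeta r \<noteq> 0"
  by (simp add: zeta_def)

text \<open>Orthogonality of characters. The summands are powers of z = \<zeta>^(V r x - a), a root
  of unity of order dividing \<open>p ^ r\<close>; the geometric sum vanishes unless z = 1, that is,
  unless the two residues agree.\<close>

lemma chi_sum:
  assumes "x \<in> \<Delta>" "a < p ^ r"
  shows "(\<Sum>l<p ^ r. inverse (zeta r) ^ (l * a) * chi r l x) = of_nat (p ^ r) * indicator (C r a) x"
proof -
  define z where "z = zeta r ^ V r x / zeta r ^ a"
  have "(\<Sum>l<p ^ r. inverse (zeta r) ^ (l * a) * chi r l x) = (\<Sum>l<p ^ r. z ^ l)"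
    by (intro sum.cong refl)
      (simp add: chi_def z_def power_inverse divide_inverse power_mult_distrib mult.commute flip: power_mult)
  also have "\<dots> = of_nat (p ^ r) * indicator (C r a) x"
  proof (cases "V r x = a")
    case True
    then show ?thesis using assms by (auto simp: z_def)
  next
    case False
    then have "zeta r ^ V r x \<noteq> zeta r ^ a"
      using inj_onD[OF zeta_inj[of r], of "V r x" a] val_less[OF assms(1), of r] assms(2) by auto
    then have "z \<noteq> 1" by (auto simp: z_def)
    moreover have "z ^ p ^ r = 1"
      by (simp add: z_def power_divide zeta_power power_mult[symmetric] mult.commute[of _ "p ^ r"])
         (simp add: power_mult zeta_power)
    ultimately show ?thesis
      using False by (auto simp: geometric_sum padic_cyl_def)
  qed
  finally show ?thesis .
qed

text \<open>Such a function is locally constant, hence continuous whatever \<open>g\<close>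
  is.\<close>

lemma continuous_map_val: "continuous_map T euclidean (\<lambda>x. g (V r x))"
  unfolding continuous_map_def by (auto simp: openin_padic_iff padic_cyl_def intro!: exI[of _ r])

lemma chi_character: "padic_character p (chi r l)"
  unfolding padic_character_def
proof (intro conjI ballI)
  show "continuous_map T euclidean (chi r l)"
    unfolding chi_def by (rule continuous_map_val)
  show "cmod (chi r l x) = 1" for x
    by (simp add: chi_def zeta_def norm_power)
  fix x y assume "x \<in> \<Delta>" "y \<in> \<Delta>"
  \<comment> \<open>This removes the reduction modulo \<open>p ^ r\<close> that adding residues
    introduces in the exponent.\<close>
  moreover have "(zeta r ^ l) ^ p ^ r = 1"
    by (metis mult.commute power_mult power_one zeta_power)
  ultimately show "chi r l (x \<otimes>\<^bsub>G\<^esub> y) = chi r l x * chi r l y"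
    by (simp add: chi_def val_padic_add power_mult power_mod_eq power_add)
qed

lemma continuous_measurable:
  fixes f :: "(nat \<Rightarrow> nat) \<Rightarrow> 'b::topological_space"
  assumes "continuous_map T euclidean f" shows "f \<in> borel_measurable B"
proof (rule borel_measurableI)
  fix S :: "'b set" assume "open S"
  then have "openin T {x \<in> topspace T. f x \<in> S}"
    using assms by (simp add: continuous_map_def)
  also have "{x \<in> topspace T. f x \<in> S} = f -` S \<inter> space B" by auto
  finally show "f -` S \<inter> space B \<in> sets B" by (rule open_sets)
qed

lemma character_measurable: "padic_character p \<psi> \<Longrightarrow> \<psi> \<in> borel_measurable B"
  by (simp add: padic_character_def continuous_measurable)

lemma integrable_bounded:
  fixes f :: "(nat \<Rightarrow> nat) \<Rightarrow> 'b::{banach, second_countable_topology}"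
  assumes "prob_space \<mu>" "sets \<mu> = sets B" "f \<in> borel_measurable B"
    and "\<And>x. x \<in> \<Delta> \<Longrightarrow> norm (f x) \<le> b"
  shows "integrable \<mu> f"
proof -
  interpret prob_space \<mu> by fact
  have "f \<in> borel_measurable \<mu>"
    using assms(2,3) measurable_cong_sets by blast
  moreover have "space \<mu> = \<Delta>"
    using sets_eq_imp_space_eq[OF assms(2)] by simp
  ultimately show ?thesis
    using assms(4) by (intro integrable_const_bound[where B = b]) auto
qed

lemma character_integrable:
  assumes "prob_space \<mu>" "sets \<mu> = sets B" "padic_character p \<psi>"
  shows "integrable \<mu> \<psi>"
  using assms by (intro integrable_bounded[where b = 1] character_measurable)
    (auto simp: padic_character_def)

text \<open>The orthogonality relation \<open>chi_sum\<close> integrated against \<mu>.\<close>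

lemma measure_cyl_fourier:
  assumes "prob_space \<mu>" "sets \<mu> = sets B" "a < p ^ r"
  shows "complex_of_real (measure \<mu> (C r a)) =
    (\<Sum>l<p ^ r. inverse (zeta r) ^ (l * a) * (\<integral>x. chi r l x \<partial>\<mu>)) / of_nat (p ^ r)"
proof -
  interpret prob_space \<mu> by fact
  have sp: "space \<mu> = \<Delta>"
    using sets_eq_imp_space_eq[OF assms(2)] by simp
  have [measurable]: "C r a \<in> sets \<mu>" using assms(2) cyl_sets by simp
  have "(\<Sum>l<p ^ r. inverse (zeta r) ^ (l * a) * (\<integral>x. chi r l x \<partial>\<mu>))
      = (\<integral>x. (\<Sum>l<p ^ r. inverse (zeta r) ^ (l * a) * chi r l x) \<partial>\<mu>)"
    using character_integrable[OF assms(1,2) chi_character]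
    by (subst Bochner_Integration.integral_sum) auto
  also have "\<dots> = (\<integral>x. of_nat (p ^ r) * complex_of_real (indicator (C r a) x) \<partial>\<mu>)"
    using assms(3) chi_sum
    by (intro Bochner_Integration.integral_cong refl) (auto simp: sp split: split_indicator)
  also have "\<dots> = of_nat (p ^ r) * complex_of_real (measure \<mu> (C r a))"
    by (simp del: of_real_indicator)
  finally show ?thesis using p_pos by simp
qed

section \<open>Measures determined by, and built from, cylinder probabilities\<close>

lemma measure_eqI_cyl:
  assumes "prob_space \<mu>" "sets \<mu> = sets B" "prob_space \<nu>" "sets \<nu> = sets B"
    and "\<And>r a. a < p ^ r \<Longrightarrow> measure \<mu> (C r a) = measure \<nu> (C r a)"
  shows "\<mu> = \<nu>"
proof -
  interpret \<mu>: prob_space \<mu> by fact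
  interpret \<nu>: prob_space \<nu> by fact
  let ?E = "insert {} (range (\<lambda>(r, a). C r a))"
  have C0: "C 0 0 = \<Delta>" by (auto simp: padic_cyl_def)
  have eq: "measure \<mu> (C r a) = measure \<nu> (C r a)" for r a
  proof (cases "a < p ^ r")
    case False
    then have "C r a = {}" using val_less by (fastforce simp: padic_cyl_def)
    then show ?thesis by simp
  qed (fact assms(5))
  show ?thesis
  \<comment> \<open>The whole group is the cylinder of level 0, so a constant sequence exhausts the
    space.\<close>
  proof (rule measure_eqI_generator_eq[where E = ?E and \<Omega> = \<Delta> and A = "\<lambda>_. \<Delta>"])
    show "Int_stable ?E"
    proof (rule Int_stableI)
      show "A \<inter> A' \<in> ?E" if "A \<in> ?E" "A' \<in> ?E" for A A'
      proof (cases "A = {} \<or> A' = {}")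
        case False
        then obtain r a s b where "A = C r a" "A' = C s b" using \<open>A \<in> ?E\<close> \<open>A' \<in> ?E\<close> by auto
        then show ?thesis using cyl_Int[of r a s b] by (elim insertE emptyE) auto
      qed auto
    qed
    show "emeasure \<mu> A = emeasure \<nu> A" if "A \<in> ?E" for A
      using that eq by (auto simp: \<mu>.emeasure_eq_measure \<nu>.emeasure_eq_measure)
    show "range (\<lambda>_. \<Delta>) \<subseteq> ?E"
      unfolding C0[symmetric] by auto
  qed (use cyl_subset assms(2,4) sets_padic_borel_cyl in auto)
qed

lemma measure_eqI_characters:
  assumes "prob_space \<mu>" "sets \<mu> = sets B" "prob_space \<nu>" "sets \<nu> = sets B"
    and "\<And>\<psi>. padic_character p \<psi> \<Longrightarrow> (\<integral>x. \<psi> x \<partial>\<mu>) = (\<integral>x. \<psi> x \<partial>\<nu>)"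
  shows "\<mu> = \<nu>"
proof (rule measure_eqI_cyl[OF assms(1-4)])
  fix r a assume "a < p ^ r"
  then have "complex_of_real (measure \<mu> (C r a)) = complex_of_real (measure \<nu> (C r a))"
    using measure_cyl_fourier[OF assms(1,2)] measure_cyl_fourier[OF assms(3,4)]
      assms(5)[OF chi_character] by simp
  then show "measure \<mu> (C r a) = measure \<nu> (C r a)" by simp
qed

text \<open>The hypothesis says that the \<open>Q r\<close> form a projective system on the groups
  Z/p^r. Their digits, read as real numbers, give consistent finite-dimensional laws on real
  sequences; the extended law is then pushed forward to the p-adic integers.\<close>

lemma ex_measure_of_pmfs:
  assumes Q: "\<And>r s. r \<le> s \<Longrightarrow> map_pmf (\<lambda>m. m mod p ^ r) (Q s) = Q r"
  shows "\<exists>\<pi>. prob_space \<pi> \<and> sets \<pi> = sets B \<and> (\<forall>r a. measure \<pi> (C r a) = pmf (Q r) a)"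
proof -
  \<comment> \<open>A level at which the residue determines all digits with positions in
    \<open>J\<close>; inserting 0 covers empty \<open>J\<close>.\<close>
  define N :: "nat set \<Rightarrow> nat" where "N J = Suc (Max (insert 0 J))" for J
  define F where "F J m = (\<lambda>j\<in>J. real (padic_digits p m j))" for J m
  define P where "P J = distr (measure_pmf (Q (N J))) (PiM J (\<lambda>_. borel)) (F J)" for J
  have N: "j < N J" if "finite J" "j \<in> J" for j J
    using that by (simp add: N_def less_Suc_eq_le)
  have F_meas: "F J \<in> measurable (measure_pmf q) (PiM J (\<lambda>_. borel))" for J q
    by (simp add: F_def space_PiM)
  have F_mod: "F J (m mod p ^ r) = F J m" if "\<And>j. j \<in> J \<Longrightarrow> j < r" for J m r
    using that by (auto simp: F_def restrict_def digits_mod)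
  interpret polish_projective UNIV P
  proof (intro polish_projective.intro projective_family.intro)
    fix J H :: "nat set" assume JH: "J \<subseteq> H" "finite H"
    then have "finite J" "N J \<le> N H" by (auto simp: N_def finite_subset intro: Max_mono)
    have "distr (P H) (PiM J (\<lambda>_. borel)) (\<lambda>f. restrict f J)
        = distr (measure_pmf (Q (N H))) (PiM J (\<lambda>_. borel)) (\<lambda>m. restrict (F H m) J)"
      unfolding P_def
      by (subst distr_distr[OF measurable_restrict_subset[OF JH(1)] F_meas]) (simp add: comp_def)
    \<comment> \<open>The digits in \<open>J\<close> depend only on the residue at level
      \<open>N J\<close>; this turns consistency of the laws into compatibility of the
      \<open>Q r\<close>.\<close>
    also have "(\<lambda>m. restrict (F H m) J) = (\<lambda>m. F J (m mod p ^ N J))"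
      using JH N[OF \<open>finite J\<close>] by (subst F_mod) (auto simp: F_def restrict_def fun_eq_iff)
    also have "distr (measure_pmf (Q (N H))) (PiM J (\<lambda>_. borel)) \<dots>
        = distr (measure_pmf (map_pmf (\<lambda>m. m mod p ^ N J) (Q (N H)))) (PiM J (\<lambda>_. borel)) (F J)"
      unfolding map_pmf_rep_eq
      by (subst distr_distr) (auto simp: comp_def F_def space_PiM)
    also have "\<dots> = P J"
      using \<open>N J \<le> N H\<close> by (simp add: Q P_def)
    finally show "P J = distr (P H) (PiM J (\<lambda>_. borel)) (\<lambda>f. restrict f J)" ..
  next
    fix J :: "nat set" assume "finite J" "J \<subseteq> UNIV"
    show "prob_space (P J)"
      unfolding P_def by (intro prob_space.prob_space_distr F_meas) (rule prob_space_measure_pmf)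
  qed
  \<comment> \<open>Kolmogorov's extension theorem is available for real coordinates only; \<open>c\<close> turns
    them back into digits.\<close>
  define c :: "(nat \<Rightarrow> real) \<Rightarrow> nat \<Rightarrow> nat" where "c x j = nat \<lfloor>x j\<rfloor> mod p" for x j
  \<comment> \<open>Used twice: with all coordinates for the measurability of \<open>c\<close>, and
    with the first \<open>r\<close> coordinates for the base of a cylinder event.\<close>
  have V_meas: "(\<lambda>x. V r (c x)) \<in> measurable (PiM J (\<lambda>_. borel)) (count_space UNIV)" if "{..<r} \<subseteq> J" for r J
  proof -
    have "(\<lambda>x. nat \<lfloor>x j\<rfloor> mod p * p ^ j) \<in> measurable (PiM J (\<lambda>_. borel :: real measure)) (count_space UNIV)" if "j < r" for j
    proof -
      have 1: "(\<lambda>x. x j) \<in> borel_measurable (PiM J (\<lambda>_. borel :: real measure))"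
        using that \<open>{..<r} \<subseteq> J\<close> by (intro measurable_component_singleton) auto
      have 2: "(\<lambda>y::real. nat \<lfloor>y\<rfloor> mod p * p ^ j) \<in> measurable borel (count_space UNIV)"
        by (rule measurable_compose[OF measurable_real_floor]) simp
      show ?thesis by (rule measurable_compose[OF 1 2])
    qed
    then have "(\<lambda>x. \<Sum>j<r. nat \<lfloor>x j\<rfloor> mod p * p ^ j) \<in> measurable (PiM J (\<lambda>_. borel :: real measure)) (borel :: nat measure)"
      unfolding measurable_borel_nat_iff[symmetric] by (intro borel_measurable_sum) auto
    then show ?thesis
      by (simp add: measurable_borel_nat_iff padic_val_def c_def)
  qed
  \<comment> \<open>Reduction modulo \<open>p\<close> inside \<open>c\<close> makes this true for
    every real sequence, not just almost surely.\<close>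
  have c_in: "c x \<in> \<Delta>" for x using p_pos by (simp add: c_def padic_set_iff)
  have "c \<in> measurable (PiM UNIV (\<lambda>_. borel)) B"
    by (intro measurable_padicI V_meas c_in) auto
  then have c_meas: "c \<in> measurable lim B"
    using measurable_cong_sets[OF sets_lim refl] by blast
  have "measure (distr lim B c) (C r a) = pmf (Q r) a" for r a
  proof -
    define X where "X = (\<lambda>y. V r (c y)) -` {a} \<inter> space (PiM {..<r} (\<lambda>_. borel))"
    have X: "X \<in> sets (PiM {..<r} (\<lambda>_. borel))"
      unfolding X_def by (intro measurable_sets[OF V_meas]) auto
    have "measure (distr lim B c) (C r a) = measure lim (c -` C r a \<inter> space lim)"
      using c_meas by (simp add: measure_distr)
    \<comment> \<open>The event involves only the first \<open>r\<close> coordinates, so its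
      probability is read off a finite-dimensional law.\<close>
    also have "c -` C r a \<inter> space lim = emb UNIV {..<r} X"
      using sets_eq_imp_space_eq[OF sets_lim] c_in
      by (auto simp: X_def prod_emb_def space_PiM padic_cyl_def padic_val_def c_def)
    also have "measure lim \<dots> = measure (P {..<r}) X"
      using X by (intro measure_lim_emb) auto
    also have "\<dots> = measure (Q (N {..<r})) (F {..<r} -` X)"
      unfolding P_def using X F_meas by (subst measure_distr) auto
    also have "F {..<r} -` X = (\<lambda>m. m mod p ^ r) -` {a}"
    proof -
      have "V r (c (F {..<r} m)) = m mod p ^ r" for m
      proof -
        have "V r (c (F {..<r} m)) = V r (padic_digits p m)"
          by (subst val_eq_iff) (auto simp: c_in c_def F_def padic_digits_def)
        then show ?thesis by (simp add: val_digits)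
      qed
      then show ?thesis by (auto simp: X_def F_def space_PiM)
    qed
    also have "measure (Q (N {..<r})) \<dots> = pmf (map_pmf (\<lambda>m. m mod p ^ r) (Q (N {..<r}))) a"
      by (simp add: pmf_map)
    \<comment> \<open>\<open>N {..<r}\<close> is \<open>r\<close>, except that it is 1 for
      \<open>r = 0\<close>; the inequality and compatibility cover both cases.\<close>
    also have "r \<le> N {..<r}"
      using N[of "{..<r}" "r - 1"] by (cases r) auto
    then have "map_pmf (\<lambda>m. m mod p ^ r) (Q (N {..<r})) = Q r" by (rule Q)
    finally show ?thesis .
  qed
  then show ?thesis
    using P.prob_space_distr[OF c_meas] by (intro exI[of _ "distr lim B c"]) auto
qed

text \<open>A cylinder is the disjoint union of its refinements at a higher level. This finite
  identity survives limits and makes the limiting weights compatible.\<close>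

lemma measure_cyl_refine:
  assumes "prob_space \<mu>" "sets \<mu> = sets B" "r \<le> s"
  shows "measure \<mu> (C r a) = (\<Sum>b | b < p ^ s \<and> b mod p ^ r = a. measure \<mu> (C s b))"
proof -
  interpret prob_space \<mu> by fact
  have "C r a = (\<Union>b\<in>{b. b < p ^ s \<and> b mod p ^ r = a}. C s b)"
    using val_less val_mod[OF _ assms(3)] by (auto simp: padic_cyl_def)
  moreover have "measure \<mu> (\<Union>b\<in>{b. b < p ^ s \<and> b mod p ^ r = a}. C s b) =
      (\<Sum>b | b < p ^ s \<and> b mod p ^ r = a. measure \<mu> (C s b))"
    using assms(2) by (intro finite_measure_finite_Union)
      (auto simp: disjoint_family_on_def padic_cyl_def[of _ s] intro: cyl_sets[unfolded padic_cyl_def])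
  ultimately show ?thesis by simp
qed

text \<open>No mass can escape, because each level has only finitely many classes: total mass 1 and
  compatibility between levels are finite sums and pass to the limit.\<close>

lemma ex_limit_measure:
  assumes "\<forall>\<^sub>F n in sequentially. prob_space (\<mu> n)" "\<And>n. sets (\<mu> n) = sets B"
    and conv: "\<And>r a. a < p ^ r \<Longrightarrow> convergent (\<lambda>n. measure (\<mu> n) (C r a))"
  shows "\<exists>\<pi>. prob_space \<pi> \<and> sets \<pi> = sets B \<and>
    (\<forall>r a. (\<lambda>n. measure (\<mu> n) (C r a)) \<longlonglongrightarrow> measure \<pi> (C r a))"
proof -
  have empty: "C r a = {}" if "\<not> a < p ^ r" for r a
    using that val_less by (fastforce simp: padic_cyl_def)
  define q where "q r a = lim (\<lambda>n. measure (\<mu> n) (C r a))" for r a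
  have q: "(\<lambda>n. measure (\<mu> n) (C r a)) \<longlonglongrightarrow> q r a" for r a
  proof (cases "a < p ^ r")
    case True
    then show ?thesis unfolding q_def by (intro convergent_LIMSEQ_iff[THEN iffD1] conv)
  qed (simp add: q_def empty lim_def limI)
  have q_nonneg: "0 \<le> q r a" for r a
    by (rule LIMSEQ_le_const[OF q]) auto
  have q_0: "q r a = 0" if "\<not> a < p ^ r" for r a
    using LIMSEQ_unique[OF q[of r a], of 0] by (simp add: empty[OF that])
  have q_refine: "q r a = (\<Sum>b | b < p ^ s \<and> b mod p ^ r = a. q s b)" if "r \<le> s" for r s a
  proof (rule LIMSEQ_unique[OF q])
    have "(\<lambda>n. \<Sum>b | b < p ^ s \<and> b mod p ^ r = a. measure (\<mu> n) (C s b))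
        \<longlonglongrightarrow> (\<Sum>b | b < p ^ s \<and> b mod p ^ r = a. q s b)"
      by (intro tendsto_sum q)
    moreover have "\<forall>\<^sub>F n in sequentially.
        (\<Sum>b | b < p ^ s \<and> b mod p ^ r = a. measure (\<mu> n) (C s b)) = measure (\<mu> n) (C r a)"
      using assms(1) by eventually_elim (simp add: measure_cyl_refine[OF _ assms(2) that])
    ultimately show "(\<lambda>n. measure (\<mu> n) (C r a)) \<longlonglongrightarrow> (\<Sum>b | b < p ^ s \<and> b mod p ^ r = a. q s b)"
      by (rule Lim_transform_eventually)
  qed
  have C0: "C 0 0 = \<Delta>" by (auto simp: padic_cyl_def)
  have "q 0 0 = 1"
  proof (rule LIMSEQ_unique[OF q])
    have "\<forall>\<^sub>F n in sequentially. 1 = measure (\<mu> n) (C 0 0)"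
      using assms(1)
    proof eventually_elim
      case (elim n)
      then show ?case
        using prob_space.prob_space[OF elim] sets_eq_imp_space_eq[OF assms(2)[of n]] by (simp add: C0)
    qed
    then show "(\<lambda>n. measure (\<mu> n) (C 0 0)) \<longlonglongrightarrow> 1"
      by (rule Lim_transform_eventually[OF tendsto_const])
  qed
  then have q_sum: "(\<Sum>b<p ^ s. q s b) = 1" for s
    using q_refine[of 0 s 0] by (simp add: lessThan_def)
  have "(\<integral>\<^sup>+a. ennreal (q r a) \<partial>count_space UNIV) = 1" for r
  proof -
    have "(\<integral>\<^sup>+a. ennreal (q r a) \<partial>count_space UNIV) = (\<Sum>a<p ^ r. ennreal (q r a))"
      by (intro nn_integral_count_space') (auto simp: q_0)
    then show ?thesis by (simp add: q_nonneg q_sum)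
  qed
  then have Q: "pmf (embed_pmf (q r)) a = q r a" for r a
    by (intro pmf_embed_pmf q_nonneg)
  have "map_pmf (\<lambda>m. m mod p ^ r) (embed_pmf (q s)) = embed_pmf (q r)" if "r \<le> s" for r s
  proof (rule pmf_eqI)
    fix a
    \<comment> \<open>The preimage of \<open>{a}\<close> is an infinite set of naturals; up to a
      null set it is the finite set over which the refinement identity sums.\<close>
    have "set_pmf (embed_pmf (q s)) \<subseteq> {..<p ^ s}"
      using q_0 by (force simp: set_pmf_iff Q)
    then have "measure (embed_pmf (q s)) ((\<lambda>m. m mod p ^ r) -` {a})
        = measure (embed_pmf (q s)) {b. b < p ^ s \<and> b mod p ^ r = a}"
      by (intro measure_pmf.finite_measure_eq_AE) (auto simp: AE_measure_pmf_iff)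
    then show "pmf (map_pmf (\<lambda>m. m mod p ^ r) (embed_pmf (q s))) a = pmf (embed_pmf (q r)) a"
      by (simp add: pmf_map measure_measure_pmf_finite Q q_refine[OF that])
  qed
  from ex_measure_of_pmfs[of "\<lambda>r. embed_pmf (q r)", OF this]
  show ?thesis using q by (auto simp: Q)
qed

end

section \<open>Weak convergence through characters\<close>

text \<open>With w the current power, w^2 - 1 = (w + 1)(w - 1), and |w - 1| at most 1/2 forces |w +
  1| to be at least 2 - 1/2 = 3/2. So each squaring multiplies the distance to 1 by at least 3/2,
  which cannot stay bounded unless it is 0.\<close>

lemma complex_eq_1_of_powers_near_1:
  fixes z :: complex
  assumes "\<And>n. cmod (z ^ 2 ^ n - 1) \<le> 1 / 2"
  shows "z = 1"
proof (rule ccontr)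
  assume "z \<noteq> 1"
  have "(3 / 2) ^ n * cmod (z - 1) \<le> cmod (z ^ 2 ^ n - 1)" for n
  proof (induction n)
    case (Suc n)
    define w where "w = z ^ 2 ^ n"
    have "2 = cmod ((w + 1) - (w - 1))" by simp
    also have "\<dots> \<le> cmod (w + 1) + cmod (w - 1)" by (rule norm_triangle_ineq4)
    finally have "3 / 2 \<le> cmod (w + 1)" using assms[of n] by (simp add: w_def)
    have "(3 / 2) ^ Suc n * cmod (z - 1) \<le> 3 / 2 * cmod (w - 1)"
      using Suc by (simp add: w_def mult.commute)
    also have "\<dots> \<le> cmod (w + 1) * cmod (w - 1)"
      using \<open>3 / 2 \<le> _\<close> by (intro mult_right_mono) auto
    also have "\<dots> = cmod (w ^ 2 - 1)"
      by (simp add: norm_mult[symmetric] power2_eq_square algebra_simps)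
    also have "w ^ 2 = z ^ 2 ^ Suc n"
      by (simp add: w_def power_mult[symmetric] mult.commute)
    finally show ?case .
  qed auto
  moreover obtain n where "1 / cmod (z - 1) < (3 / 2) ^ n"
    using real_arch_pow[of "3 / 2"] by auto
  then have "1 < (3 / 2) ^ n * cmod (z - 1)"
    using \<open>z \<noteq> 1\<close> by (simp add: field_simps)
  ultimately show False using assms[of n] by (smt (verit) field_sum_of_halves)
qed

text \<open>All factors 1 + c and exp c lie in the unit disc, so the two products differ by at most
  the sum of the differences of their factors. Each difference is quadratic in c.\<close>

lemma prod_tendsto_exp:
  fixes c :: "nat \<Rightarrow> 'i \<Rightarrow> complex" and A :: "nat \<Rightarrow> 'i set"
  assumes fin: "\<And>n. finite (A n)"
    and norm_le: "\<forall>\<^sub>F n in sequentially. \<forall>k\<in>A n. cmod (1 + c n k) \<le> 1 \<and> cmod (c n k) \<le> b n"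
    and b: "b \<longlonglongrightarrow> 0"
    and bound: "\<forall>\<^sub>F n in sequentially. (\<Sum>k\<in>A n. cmod (c n k)) \<le> L"
    and lim: "(\<lambda>n. \<Sum>k\<in>A n. c n k) \<longlonglongrightarrow> s"
  shows "(\<lambda>n. \<Prod>k\<in>A n. 1 + c n k) \<longlonglongrightarrow> exp s"
proof -
  have estimate: "cmod ((\<Prod>k\<in>A n. 1 + c n k) - exp (\<Sum>k\<in>A n. c n k)) \<le> exp 2 * \<bar>b n\<bar> * L"
    if 1: "\<forall>k\<in>A n. cmod (1 + c n k) \<le> 1 \<and> cmod (c n k) \<le> b n"
      and 2: "(\<Sum>k\<in>A n. cmod (c n k)) \<le> L" for n
  proof -
    have "cmod ((\<Prod>k\<in>A n. 1 + c n k) - (\<Prod>k\<in>A n. exp (c n k)))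
        \<le> (\<Sum>k\<in>A n. cmod (1 + c n k - exp (c n k)))"
    proof (rule norm_prod_diff)
      fix k assume "k \<in> A n"
      then have "cmod (1 + c n k) \<le> 1" using 1 by auto
      \<comment> \<open>Since |1 + c| is at most 1, the real part of c is at most 0, so exp c lies
        in the unit disc too.\<close>
      then have "Re (1 + c n k) \<le> 1" using complex_Re_le_cmod order_trans by blast
      then show "cmod (exp (c n k)) \<le> 1" by simp
    qed (use 1 in auto)
    also have "\<dots> \<le> (\<Sum>k\<in>A n. exp 2 * \<bar>b n\<bar> * cmod (c n k))"
    proof (rule sum_mono)
      fix k assume k: "k \<in> A n"
      have "cmod (c n k) = cmod ((1 + c n k) - 1)" by simp
      also have "\<dots> \<le> cmod (1 + c n k) + cmod 1" by (rule norm_triangle_ineq4)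
      \<comment> \<open>Source of the constant \<open>exp 2\<close>: |c| is at most |1 + c| +
        1.\<close>
      finally have "\<bar>Re (c n k)\<bar> \<le> 2"
        using 1 k abs_Re_le_cmod[of "c n k"] by force
      have "cmod (c n k) \<le> b n" using 1 k by blast
      \<comment> \<open>The absolute value keeps the final bound monotone in the sum also when
        \<open>A n\<close> is empty, where nothing forces \<open>b n\<close> to be
        nonnegative.\<close>
      then have "cmod (c n k) \<le> \<bar>b n\<bar>" by linarith
      have "cmod (1 + c n k - exp (c n k)) = cmod (exp (c n k) - (\<Sum>i\<le>1. c n k ^ i / fact i))"
        by (simp add: norm_minus_commute)
      also have "\<dots> \<le> exp \<bar>Re (c n k)\<bar> * cmod (c n k) ^ Suc 1 / fact 1"
        by (rule Taylor_exp)
      also have "\<dots> = exp \<bar>Re (c n k)\<bar> * cmod (c n k) * cmod (c n k)"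
        by simp
      also have "\<dots> \<le> exp 2 * \<bar>b n\<bar> * cmod (c n k)"
        by (rule mult_right_mono[OF mult_mono])
          (use \<open>\<bar>Re (c n k)\<bar> \<le> 2\<close> \<open>cmod (c n k) \<le> \<bar>b n\<bar>\<close> in simp_all)
      finally show "cmod (1 + c n k - exp (c n k)) \<le> exp 2 * \<bar>b n\<bar> * cmod (c n k)"
        by assumption
    qed
    also have "\<dots> \<le> exp 2 * \<bar>b n\<bar> * L"
      unfolding sum_distrib_left[symmetric] using 2 by (intro mult_left_mono) auto
    finally show ?thesis by (simp add: exp_sum fin)
  qed
  have "(\<lambda>n. exp 2 * \<bar>b n\<bar> * L) \<longlonglongrightarrow> exp 2 * \<bar>0\<bar> * L"
    by (intro tendsto_intros b)
  then have 0: "(\<lambda>n. exp 2 * \<bar>b n\<bar> * L) \<longlonglongrightarrow> 0" by simp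
  have "\<forall>\<^sub>F n in sequentially.
      cmod ((\<Prod>k\<in>A n. 1 + c n k) - exp (\<Sum>k\<in>A n. c n k)) \<le> exp 2 * \<bar>b n\<bar> * L"
    using norm_le bound by eventually_elim (rule estimate)
  from Lim_null_comparison[OF this 0]
  have "(\<lambda>n. (\<Prod>k\<in>A n. 1 + c n k) - exp (\<Sum>k\<in>A n. c n k)) \<longlonglongrightarrow> 0" .
  from tendsto_add[OF this tendsto_exp[OF lim]] show ?thesis by simp
qed

section \<open>Integrals of functions of a residue, and weak convergence\<close>

context padic
begin

text \<open>The integrand is a simple function. Finiteness is asked only on classes where
  \<open>k\<close> is nonzero, so that a measure with infinite mass on class 0 is covered when
  \<open>k 0 = 0\<close>.\<close>

lemma has_integral_val:
  fixes k :: "nat \<Rightarrow> 'b::{banach, second_countable_topology}"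
  assumes "sets \<mu> = sets B" "\<And>a. k a \<noteq> 0 \<Longrightarrow> emeasure \<mu> (C r a) < \<infinity>"
  shows "has_bochner_integral \<mu> (\<lambda>x. k (V r x)) (\<Sum>a<p ^ r. measure \<mu> (C r a) *\<^sub>R k a)"
proof -
  have sp: "space \<mu> = \<Delta>"
    using sets_eq_imp_space_eq[OF assms(1)] by simp
  have "has_bochner_integral \<mu> (\<lambda>x. indicator (C r a) x *\<^sub>R k a) (measure \<mu> (C r a) *\<^sub>R k a)" for a
  proof (cases "k a = 0")
    case False
    then show ?thesis
      using assms by (intro has_bochner_integral_scaleR_left has_bochner_integral_real_indicator) auto
  qed (simp add: has_bochner_integral_zero)
  then have "has_bochner_integral \<mu> (\<lambda>x. \<Sum>a<p ^ r. indicator (C r a) x *\<^sub>R k a)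
      (\<Sum>a<p ^ r. measure \<mu> (C r a) *\<^sub>R k a)"
    by (intro has_bochner_integral_sum)
  moreover have "(\<Sum>a<p ^ r. indicator (C r a) x *\<^sub>R k a) = k (V r x)" if "x \<in> \<Delta>" for x
  proof -
    have "(\<Sum>a<p ^ r. indicator (C r a) x *\<^sub>R k a) = (\<Sum>a<p ^ r. if a = V r x then k a else 0)"
      using that by (intro sum.cong refl) (auto simp: padic_cyl_def)
    then show ?thesis using val_less[OF that] by simp
  qed
  ultimately show ?thesis
    by (subst has_bochner_integral_cong[OF refl _ refl]) (auto simp: sp)
qed

lemma
  fixes k :: "nat \<Rightarrow> 'b::{banach, second_countable_topology}"
  assumes "prob_space \<mu>" "sets \<mu> = sets B"
  shows integrable_val: "integrable \<mu> (\<lambda>x. k (V r x))"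
    and integral_val: "(\<integral>x. k (V r x) \<partial>\<mu>) = (\<Sum>a<p ^ r. measure \<mu> (C r a) *\<^sub>R k a)"
proof -
  interpret prob_space \<mu> by fact
  have "has_bochner_integral \<mu> (\<lambda>x. k (V r x)) (\<Sum>a<p ^ r. measure \<mu> (C r a) *\<^sub>R k a)"
    using assms(2) by (intro has_integral_val) (auto simp: less_top[symmetric])
  then show "integrable \<mu> (\<lambda>x. k (V r x))"
    "(\<integral>x. k (V r x) \<partial>\<mu>) = (\<Sum>a<p ^ r. measure \<mu> (C r a) *\<^sub>R k a)"
    by (auto simp: has_bochner_integral_iff)
qed

lemma integral_val_tendsto:
  fixes k :: "nat \<Rightarrow> 'b::{banach, second_countable_topology}"
  assumes "\<forall>\<^sub>F n in sequentially. prob_space (\<mu> n)" "\<And>n. sets (\<mu> n) = sets B"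
    and "prob_space \<pi>" "sets \<pi> = sets B"
    and "\<And>r a. (\<lambda>n. measure (\<mu> n) (C r a)) \<longlonglongrightarrow> measure \<pi> (C r a)"
  shows "(\<lambda>n. \<integral>x. k (V r x) \<partial>\<mu> n) \<longlonglongrightarrow> (\<integral>x. k (V r x) \<partial>\<pi>)"
proof -
  have "(\<lambda>n. \<Sum>a<p ^ r. measure (\<mu> n) (C r a) *\<^sub>R k a) \<longlonglongrightarrow> (\<integral>x. k (V r x) \<partial>\<pi>)"
    unfolding integral_val[OF assms(3,4)] by (intro tendsto_intros assms(5))
  moreover have "\<forall>\<^sub>F n in sequentially.
      (\<Sum>a<p ^ r. measure (\<mu> n) (C r a) *\<^sub>R k a) = (\<integral>x. k (V r x) \<partial>\<mu> n)"
    using assms(1) by eventually_elim (simp add: integral_val assms(2))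
  ultimately show ?thesis by (rule Lim_transform_eventually)
qed

text \<open>The lower envelopes \<open>inf f\<close> over the cylinders of level \<open>r\<close> increase to \<open>f\<close>; this replaces
  uniform continuity, so compactness of the group is never used.\<close>

lemma cyl_tendsto_integral_lower:
  fixes f :: "(nat \<Rightarrow> nat) \<Rightarrow> real"
  assumes \<mu>: "\<forall>\<^sub>F n in sequentially. prob_space (\<mu> n)" "\<And>n. sets (\<mu> n) = sets B"
    and \<pi>: "prob_space \<pi>" "sets \<pi> = sets B"
    and lim: "\<And>r a. (\<lambda>n. measure (\<mu> n) (C r a)) \<longlonglongrightarrow> measure \<pi> (C r a)"
    and f: "continuous_map T euclidean f" "\<And>x. x \<in> \<Delta> \<Longrightarrow> \<bar>f x\<bar> \<le> b"
    and "0 < \<epsilon>"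
  shows "\<forall>\<^sub>F n in sequentially. (\<integral>x. f x \<partial>\<pi>) - \<epsilon> < (\<integral>x. f x \<partial>\<mu> n)"
proof -
  interpret \<pi>: prob_space \<pi> by fact
  define h where "h r a = (INF y\<in>C r a. f y)" for r a
  have bdd: "bdd_below (f ` C r a)" for r a
    using f(2) cyl_subset by (intro bdd_belowI2[of _ "- b"]) (force simp: abs_le_iff)
  have h_le: "h r (V r x) \<le> f x" if "x \<in> \<Delta>" for r x
    unfolding h_def using that by (intro cINF_lower bdd) auto
  have h_ge: "m \<le> h r (V r x)" if "x \<in> \<Delta>" "\<And>y. y \<in> C r (V r x) \<Longrightarrow> m \<le> f y" for r x m
    unfolding h_def using that by (intro cINF_greatest) (use in_cyl_val in blast)+
  have h_lim: "(\<lambda>r. h r (V r x)) \<longlonglongrightarrow> f x" if x: "x \<in> \<Delta>" for x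
  proof (rule LIMSEQ_I)
    fix e :: real assume "0 < e"
    \<comment> \<open>Only lower semicontinuity at \<open>x\<close> is used: some cylinder around
      \<open>x\<close> has f above f x - e/2, and so do the infima at all finer levels. Halving
      \<open>e\<close> makes up for the infimum giving only a weak inequality.\<close>
    have "openin T {y \<in> topspace T. f y \<in> {f x - e / 2<..}}"
      using f(1) open_greaterThan unfolding continuous_map_def open_openin[symmetric] by blast
    moreover have "x \<in> {y \<in> topspace T. f y \<in> {f x - e / 2<..}}"
      using x \<open>0 < e\<close> by simp
    ultimately obtain s where s: "C s (V s x) \<subseteq> {y \<in> topspace T. f y \<in> {f x - e / 2<..}}"
      unfolding openin_padic_iff by blast
    have "norm (h r (V r x) - f x) < e" if "s \<le> r" for r
    proof -
      have "f x - e / 2 \<le> h r (V r x)"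
        using s cyl_mono[OF x that] by (intro h_ge x) force
      then show ?thesis using h_le[OF x, of r] \<open>0 < e\<close> by simp
    qed
    then show "\<exists>s. \<forall>r\<ge>s. norm (h r (V r x) - f x) < e" by blast
  qed
  have sp: "space \<nu> = \<Delta>" if "sets \<nu> = sets B" for \<nu>
    using sets_eq_imp_space_eq[OF that] by simp
  have f_int: "integrable \<nu> f" if "prob_space \<nu>" "sets \<nu> = sets B" for \<nu>
    using that f by (intro integrable_bounded continuous_measurable) auto
  have "(\<lambda>r. \<integral>x. h r (V r x) \<partial>\<pi>) \<longlonglongrightarrow> (\<integral>x. f x \<partial>\<pi>)"
  proof (rule integral_dominated_convergence[where w = "\<lambda>_. b"])
    show "(\<lambda>x. h r (V r x)) \<in> borel_measurable \<pi>" for r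
      using integrable_val[OF \<pi>] by (rule borel_measurable_integrable)
    show "AE x in \<pi>. norm (h r (V r x)) \<le> b" for r
    proof (rule AE_I2)
      fix x assume "x \<in> space \<pi>"
      then have x: "x \<in> \<Delta>" by (simp add: sp \<pi>)
      have "- b \<le> h r (V r x)"
        using f(2) cyl_subset by (intro h_ge x) (force simp: abs_le_iff)
      then show "norm (h r (V r x)) \<le> b"
        using h_le[OF x, of r] f(2)[OF x] by simp
    qed
  qed (use f_int[OF \<pi>] h_lim in \<open>auto simp: sp \<pi>\<close>)
  then have "\<forall>\<^sub>F r in sequentially. (\<integral>x. f x \<partial>\<pi>) - \<epsilon> < (\<integral>x. h r (V r x) \<partial>\<pi>)"
    using \<open>0 < \<epsilon>\<close> by (intro order_tendstoD) auto
  \<comment> \<open>One level is fixed here; at that level the integrals are finite sums and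
    converge.\<close>
  then obtain r where r: "(\<integral>x. f x \<partial>\<pi>) - \<epsilon> < (\<integral>x. h r (V r x) \<partial>\<pi>)"
    using eventually_happens trivial_limit_sequentially by blast
  have "\<forall>\<^sub>F n in sequentially. (\<integral>x. f x \<partial>\<pi>) - \<epsilon> < (\<integral>x. h r (V r x) \<partial>\<mu> n)"
    using integral_val_tendsto[OF \<mu> \<pi> lim] r by (rule order_tendstoD)
  then show ?thesis
    using \<mu>(1)
  proof eventually_elim
    case (elim n)
    have "(\<integral>x. h r (V r x) \<partial>\<mu> n) \<le> (\<integral>x. f x \<partial>\<mu> n)"
      using elim \<mu>(2) by (intro integral_mono integrable_val f_int h_le) (auto simp: sp)
    then show ?case using elim by simp
  qed
qed

lemma weakly_converges_cyl:
  assumes \<mu>: "\<forall>\<^sub>F n in sequentially. prob_space (\<mu> n)" "\<And>n. sets (\<mu> n) = sets B"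
    and \<pi>: "prob_space \<pi>" "sets \<pi> = sets B"
    and lim: "\<And>r a. (\<lambda>n. measure (\<mu> n) (C r a)) \<longlonglongrightarrow> measure \<pi> (C r a)"
  shows "weakly_converges T \<mu> \<pi>"
  unfolding weakly_converges_def
proof (intro allI impI)
  fix f :: "(nat \<Rightarrow> nat) \<Rightarrow> real"
  assume "continuous_map T euclidean f \<and> bounded (f ` topspace T)"
  then have f: "continuous_map T euclidean f" and "bounded (f ` \<Delta>)" by auto
  then obtain b where b: "\<And>x. x \<in> \<Delta> \<Longrightarrow> \<bar>f x\<bar> \<le> b"
    by (auto simp: bounded_iff)
  \<comment> \<open>The one-sided estimate applied to -f supplies the upper bound.\<close>
  have mf: "continuous_map T euclidean (\<lambda>x. - f x)"
    using f by (simp add: continuous_map_minus)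
  show "(\<lambda>n. \<integral>x. f x \<partial>\<mu> n) \<longlonglongrightarrow> (\<integral>x. f x \<partial>\<pi>)"
  proof (rule tendstoI)
    fix e :: real assume "0 < e"
    then have "\<forall>\<^sub>F n in sequentially. (\<integral>x. f x \<partial>\<pi>) - e < (\<integral>x. f x \<partial>\<mu> n)"
      and "\<forall>\<^sub>F n in sequentially. (\<integral>x. - f x \<partial>\<pi>) - e < (\<integral>x. - f x \<partial>\<mu> n)"
      using cyl_tendsto_integral_lower[OF \<mu> \<pi> lim f b]
        cyl_tendsto_integral_lower[OF \<mu> \<pi> lim mf, of b e] b by auto
    then show "\<forall>\<^sub>F n in sequentially. dist (\<integral>x. f x \<partial>\<mu> n) (\<integral>x. f x \<partial>\<pi>) < e"
      by eventually_elim (auto simp: dist_real_def)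
  qed
qed

section \<open>Characters and their limits\<close>

lemma character_zero: "padic_character p \<psi> \<Longrightarrow> \<psi> padic_zero = 1"
proof -
  assume "padic_character p \<psi>"
  moreover have "padic_add p padic_zero padic_zero = padic_zero"
    using G.l_one[of padic_zero] by simp
  ultimately have "\<psi> padic_zero = \<psi> padic_zero * \<psi> padic_zero" "cmod (\<psi> padic_zero) = 1"
    unfolding padic_character_def by (metis group_simps(2) zero_in_padic_set)+
  then show ?thesis by (metis mult_cancel_left1 norm_zero zero_neq_one)
qed

lemma character_finprod:
  assumes "padic_character p \<psi>" "finite I" "\<And>i. i \<in> I \<Longrightarrow> x i \<in> \<Delta>"
  shows "\<psi> (\<Otimes>\<^bsub>G\<^esub>i\<in>I. x i) = (\<Prod>i\<in>I. \<psi> (x i))"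
  using assms(2,3)
proof (induction I rule: finite_induct)
  case empty
  then show ?case using character_zero[OF assms(1)] by simp
next
  case (insert i I)
  then have "x \<in> I \<rightarrow> carrier G" "x i \<in> carrier G" "(\<Otimes>\<^bsub>G\<^esub>i\<in>I. x i) \<in> \<Delta>"
    using G.finprod_closed[of x I] by auto
  moreover from this have "\<psi> (x i \<otimes>\<^bsub>G\<^esub> (\<Otimes>\<^bsub>G\<^esub>i\<in>I. x i)) = \<psi> (x i) * \<psi> (\<Otimes>\<^bsub>G\<^esub>i\<in>I. x i)"
    using assms(1) unfolding padic_character_def by simp
  ultimately show ?case
    using insert by (simp add: G.finprod_insert del: group_simps(2))
qed

text \<open>The circle has no small subgroups.\<close>

lemma character_trivial_on_cyl:
  assumes \<psi>: "padic_character p \<psi>"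
  obtains r where "\<And>x. x \<in> C r 0 \<Longrightarrow> \<psi> x = 1"
proof -
  have "openin T {x \<in> topspace T. \<psi> x \<in> ball 1 (1 / 2)}"
    using \<psi> open_ball unfolding padic_character_def continuous_map_def by (simp del: mem_ball)
  moreover have "padic_zero \<in> {x \<in> topspace T. \<psi> x \<in> ball 1 (1 / 2)}"
    by (simp add: character_zero[OF \<psi>])
  ultimately obtain r where "C r (V r padic_zero) \<subseteq> {x \<in> topspace T. \<psi> x \<in> ball 1 (1 / 2)}"
    unfolding openin_padic_iff by blast
  then have r: "cmod (\<psi> x - 1) < 1 / 2" if "x \<in> C r 0" for x
    using that by (force simp: dist_norm norm_minus_commute)
  have "\<psi> x = 1" if x: "x \<in> C r 0" for x
  proof (rule complex_eq_1_of_powers_near_1)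
    fix n
    \<comment> \<open>The cylinder is a subgroup, so repeated doubling stays in it; each doubling
      squares the value of \<psi>.\<close>
    have "\<exists>y\<in>C r 0. \<psi> y = \<psi> x ^ 2 ^ n"
    proof (induction n)
      case (Suc n)
      then obtain y where y: "y \<in> C r 0" "\<psi> y = \<psi> x ^ 2 ^ n" by blast
      then have "y \<in> \<Delta>" by (simp add: padic_cyl_def)
      then have "padic_add p y y \<in> C r 0" "\<psi> (padic_add p y y) = \<psi> y * \<psi> y"
        using y \<psi> by (auto simp: padic_cyl_def padic_add_in val_padic_add padic_character_def)
      then show ?case
        using y(2) by (intro bexI[of _ "padic_add p y y"]) (simp_all add: power_add[symmetric] mult_2)
    qed (use x in auto)
    then show "cmod (\<psi> x ^ 2 ^ n - 1) \<le> 1 / 2" using r by fastforce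
  qed
  then show ?thesis by (rule that)
qed

text \<open>\<open>x\<close> and the representative of its residue differ by an element of a
  subgroup on which \<psi> is 1. The level is taken as a successor to fit the hypotheses, which are
  indexed by the last digit \<open>d\<close>.\<close>

lemma character_eq_val:
  assumes \<psi>: "padic_character p \<psi>"
  obtains d where "\<And>x. x \<in> \<Delta> \<Longrightarrow> \<psi> x = \<psi> (padic_digits p (V (Suc d) x))"
proof -
  obtain r where r: "\<And>x. x \<in> C r 0 \<Longrightarrow> \<psi> x = 1"
    using character_trivial_on_cyl[OF \<psi>] by blast
  have "\<psi> x = \<psi> (padic_digits p (V (Suc r) x))" if x: "x \<in> \<Delta>" for x
  proof -
    let ?y = "padic_digits p (V (Suc r) x)"
    have "V (Suc r) ?y = V (Suc r) x"
      using val_less[OF x, of "Suc r"] by (simp add: val_digits)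
    then have "x \<in> ?y <#\<^bsub>G\<^esub> padic_Lambda p (Suc r)"
      using x by (simp add: coset_eq_cyl padic_cyl_def)
    then obtain h where h: "h \<in> C (Suc r) 0" "x = ?y \<otimes>\<^bsub>G\<^esub> h"
      unfolding l_coset_def Lambda_eq_cyl by blast
    have "h \<in> C r 0"
      using h(1) cyl_mono[OF zero_in_padic_set, of r "Suc r"] by auto
    then have "\<psi> (?y \<otimes>\<^bsub>G\<^esub> h) = \<psi> ?y * 1"
      using \<psi> r[of h] cyl_subset[of r 0] digits_in unfolding padic_character_def by (metis subsetD)
    then show ?thesis using h(2) by (metis mult_1_right)
  qed
  then show ?thesis by (rule that)
qed

text \<open>The analogue of Levy's continuity theorem. The limits \<phi> are not assumed to be the
  transform of a measure, and finiteness of the levels stands in for tightness.\<close>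

lemma weakly_converges_of_characters:
  assumes \<mu>: "\<forall>\<^sub>F n in sequentially. prob_space (\<mu> n)" "\<And>n. sets (\<mu> n) = sets B"
    and lim: "\<And>\<psi>. padic_character p \<psi> \<Longrightarrow> (\<lambda>n. \<integral>x. \<psi> x \<partial>\<mu> n) \<longlonglongrightarrow> \<phi> \<psi>"
  obtains \<pi> where "prob_space \<pi>" "sets \<pi> = sets B"
    "\<And>\<psi>. padic_character p \<psi> \<Longrightarrow> (\<integral>x. \<psi> x \<partial>\<pi>) = \<phi> \<psi>" "weakly_converges T \<mu> \<pi>"
proof -
  have "convergent (\<lambda>n. measure (\<mu> n) (C r a))" if a: "a < p ^ r" for r a
  proof -
    let ?L = "(\<Sum>l<p ^ r. inverse (zeta r) ^ (l * a) * \<phi> (chi r l)) / of_nat (p ^ r)"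
    have "(\<lambda>n. (\<Sum>l<p ^ r. inverse (zeta r) ^ (l * a) * (\<integral>x. chi r l x \<partial>\<mu> n)) / of_nat (p ^ r)) \<longlonglongrightarrow> ?L"
      using p_pos by (intro tendsto_intros lim chi_character) auto
    moreover have "\<forall>\<^sub>F n in sequentially.
        (\<Sum>l<p ^ r. inverse (zeta r) ^ (l * a) * (\<integral>x. chi r l x \<partial>\<mu> n)) / of_nat (p ^ r)
        = complex_of_real (measure (\<mu> n) (C r a))"
      using \<mu>(1) by eventually_elim (simp only: measure_cyl_fourier[OF _ \<mu>(2) a])
    ultimately have "(\<lambda>n. complex_of_real (measure (\<mu> n) (C r a))) \<longlonglongrightarrow> ?L"
      by (rule Lim_transform_eventually)
    from tendsto_Re[OF this] show ?thesis by (auto simp: convergent_def)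
  qed
  from ex_limit_measure[OF \<mu> this] obtain \<pi> where \<pi>: "prob_space \<pi>" "sets \<pi> = sets B"
    and cyl: "\<And>r a. (\<lambda>n. measure (\<mu> n) (C r a)) \<longlonglongrightarrow> measure \<pi> (C r a)" by blast
  have "(\<integral>x. \<psi> x \<partial>\<pi>) = \<phi> \<psi>" if \<psi>: "padic_character p \<psi>" for \<psi>
  proof -
    obtain d where d: "\<And>x. x \<in> \<Delta> \<Longrightarrow> \<psi> x = \<psi> (padic_digits p (V (Suc d) x))"
      using character_eq_val[OF \<psi>] by blast
    have "(\<integral>x. \<psi> x \<partial>\<nu>) = (\<integral>x. \<psi> (padic_digits p (V (Suc d) x)) \<partial>\<nu>)" if "sets \<nu> = sets B" for \<nu>
      using sets_eq_imp_space_eq[OF that] by (intro Bochner_Integration.integral_cong refl d) simp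
    then have "(\<lambda>n. \<integral>x. \<psi> x \<partial>\<mu> n) \<longlonglongrightarrow> (\<integral>x. \<psi> x \<partial>\<pi>)"
      \<comment> \<open>Since \<psi> depends on one residue only, cylinder convergence already gives
        the limit of its integrals, and limits are unique.\<close>
      using integral_val_tendsto[OF \<mu> \<pi> cyl, where k = "\<lambda>m. \<psi> (padic_digits p m)"] \<mu>(2) \<pi>(2)
      by simp
    then show ?thesis using lim[OF \<psi>] LIMSEQ_unique by blast
  qed
  then show ?thesis
    using that \<pi> weakly_converges_cyl[OF \<mu> \<pi> cyl] by blast
qed

end

section \<open>Rowwise independent arrays\<close>

text \<open>Row 0 is unconstrained, so every identity about rows is used only eventually.\<close>

locale padic_array = padic +
  fixes M :: "nat \<Rightarrow> 'a measure"
    and K :: "nat \<Rightarrow> nat"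
    and X :: "nat \<Rightarrow> nat \<Rightarrow> 'a \<Rightarrow> (nat \<Rightarrow> nat)"
    and \<eta> :: "(nat \<Rightarrow> nat) measure"
  assumes prob_M: "\<And>n. n \<ge> 1 \<Longrightarrow> prob_space (M n)"
    and K_pos: "\<And>n. n \<ge> 1 \<Longrightarrow> K n \<ge> 1"
    and X_meas: "\<And>n k. n \<ge> 1 \<Longrightarrow> k \<in> {1..K n} \<Longrightarrow> X n k \<in> measurable (M n) (padic_borel p)"
    and X_indep: "\<And>n. n \<ge> 1 \<Longrightarrow>
      prob_space.indep_vars (M n) (\<lambda>_. padic_borel p) (X n) {1..K n}"
    and levy: "padic_levy_measure p \<eta>"
    and max_digits: "\<And>d. (\<lambda>n. MAX k\<in>{1..K n}.
      measure (M n) {\<omega> \<in> space (M n). \<exists>j\<le>d. X n k \<omega> j \<noteq> 0}) \<longlonglongrightarrow> 0"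
    and sum_digits: "\<And>d (l :: nat \<Rightarrow> nat).
      (\<forall>j\<le>d. l j \<in> {0..p - 1}) \<Longrightarrow> (\<exists>j\<le>d. l j \<noteq> 0) \<Longrightarrow>
      (\<lambda>n. \<Sum>k=1..K n. measure (M n) {\<omega> \<in> space (M n). \<forall>j\<le>d. X n k \<omega> j = l j})
        \<longlonglongrightarrow> measure \<eta> {x \<in> padic_set p. \<forall>j\<le>d. x j = l j}"
begin

section \<open>Laws of the entries and the hypotheses in terms of residues\<close>

definition \<mu> :: "nat \<Rightarrow> nat \<Rightarrow> (nat \<Rightarrow> nat) measure" where
  "\<mu> n k = distr (M n) B (X n k)"

lemma X_in: "n \<ge> 1 \<Longrightarrow> k \<in> {1..K n} \<Longrightarrow> \<omega> \<in> space (M n) \<Longrightarrow> X n k \<omega> \<in> \<Delta>"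
  using measurable_space[OF X_meas] by simp

lemma prob_\<mu>: "n \<ge> 1 \<Longrightarrow> k \<in> {1..K n} \<Longrightarrow> prob_space (\<mu> n k)"
  unfolding \<mu>_def by (intro prob_space.prob_space_distr prob_M X_meas)

lemma sets_\<mu>: "sets (\<mu> n k) = sets B"
  by (simp add: \<mu>_def)

lemma measure_\<mu>:
  assumes "n \<ge> 1" "k \<in> {1..K n}" "A \<in> sets B"
  shows "measure (\<mu> n k) A = measure (M n) {\<omega> \<in> space (M n). X n k \<omega> \<in> A}"
  unfolding \<mu>_def using X_meas[OF assms(1,2)] assms(3)
  by (subst measure_distr) (auto intro!: arg_cong[where f = "measure (M n)"])

lemma sets_\<eta>: "sets \<eta> = sets B"
  and emeasure_\<eta>_finite: "emeasure \<eta> (\<Delta> - padic_Lambda p r) < \<infinity>"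
  using levy by (auto simp: padic_levy_measure_def)

text \<open>A nonzero class misses \<open>padic_Lambda p r\<close>, outside of which a Levy measure
  is finite.\<close>

lemma emeasure_\<eta>_cyl:
  assumes "a \<noteq> 0" shows "emeasure \<eta> (C r a) < \<infinity>"
proof -
  have "emeasure \<eta> (C r a) \<le> emeasure \<eta> (\<Delta> - padic_Lambda p r)"
  proof (rule emeasure_mono)
    show "C r a \<subseteq> \<Delta> - padic_Lambda p r"
      using assms by (auto simp: Lambda_eq_cyl padic_cyl_def)
    show "\<Delta> - padic_Lambda p r \<in> sets \<eta>"
      using sets.compl_sets[OF cyl_sets[of r 0]] by (simp add: sets_\<eta> Lambda_eq_cyl)
  qed
  then show ?thesis using emeasure_\<eta>_finite le_less_trans by blast
qed

lemma max_tendsto: "(\<lambda>n. MAX k\<in>{1..K n}. measure (\<mu> n k) (\<Delta> - C (Suc d) 0)) \<longlonglongrightarrow> 0"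
proof (rule Lim_transform_eventually[OF max_digits[of d]])
  have [simp]: "\<Delta> - C (Suc d) 0 \<in> sets B"
    using sets.compl_sets[OF cyl_sets[of "Suc d" 0]] by simp
  show "\<forall>\<^sub>F n in sequentially.
      (MAX k\<in>{1..K n}. measure (M n) {\<omega> \<in> space (M n). \<exists>j\<le>d. X n k \<omega> j \<noteq> 0})
      = (MAX k\<in>{1..K n}. measure (\<mu> n k) (\<Delta> - C (Suc d) 0))"
    using eventually_ge_at_top[of 1]
  proof eventually_elim
    case (elim n)
    have "measure (M n) {\<omega> \<in> space (M n). \<exists>j\<le>d. X n k \<omega> j \<noteq> 0}
        = measure (\<mu> n k) (\<Delta> - C (Suc d) 0)" if "k \<in> {1..K n}" for k
      using X_in[OF elim that] ex_digit_nonzero_iff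
      by (subst measure_\<mu>[OF elim that]) (auto intro!: arg_cong[where f = "measure (M n)"])
    then show ?case by (intro arg_cong[where f = Max] image_cong) auto
  qed
qed

text \<open>Hypothesis (ii) for the digits of \<open>a\<close>; that \<open>a\<close> is positive
  and below \<open>p ^ Suc d\<close> ensures that some digit among 0, ..., d is nonzero.\<close>

lemma sum_tendsto:
  assumes "0 < a" "a < p ^ Suc d"
  shows "(\<lambda>n. \<Sum>k=1..K n. measure (\<mu> n k) (C (Suc d) a)) \<longlonglongrightarrow> measure \<eta> (C (Suc d) a)"
proof -
  have "\<forall>j\<le>d. padic_digits p a j \<in> {0..p - 1}"
    using digits_in[of a] by (simp add: padic_set_def)
  moreover have "\<exists>j\<le>d. padic_digits p a j \<noteq> 0"
    using assms by (subst ex_digit_nonzero_iff) (auto simp: padic_cyl_def val_digits)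
  moreover have "{x \<in> \<Delta>. \<forall>j\<le>d. x j = padic_digits p a j} = C (Suc d) a"
    using digits_eq_iff[OF _ assms(2)] cyl_subset by blast
  ultimately have "(\<lambda>n. \<Sum>k=1..K n. measure (M n)
      {\<omega> \<in> space (M n). \<forall>j\<le>d. X n k \<omega> j = padic_digits p a j}) \<longlonglongrightarrow> measure \<eta> (C (Suc d) a)"
    using sum_digits[of d "padic_digits p a"] by simp
  moreover have "\<forall>\<^sub>F n in sequentially.
      (\<Sum>k=1..K n. measure (M n) {\<omega> \<in> space (M n). \<forall>j\<le>d. X n k \<omega> j = padic_digits p a j})
      = (\<Sum>k=1..K n. measure (\<mu> n k) (C (Suc d) a))"
    using eventually_ge_at_top[of 1]
  proof eventually_elim
    case (elim n)
    show ?case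
    proof (rule sum.cong[OF refl])
      fix k assume k: "k \<in> {1..K n}"
      show "measure (M n) {\<omega> \<in> space (M n). \<forall>j\<le>d. X n k \<omega> j = padic_digits p a j}
          = measure (\<mu> n k) (C (Suc d) a)"
        using X_in[OF elim k] digits_eq_iff[OF _ assms(2)]
        by (subst measure_\<mu>[OF elim k cyl_sets]) (auto intro!: arg_cong[where f = "measure (M n)"])
    qed
  qed
  ultimately show ?thesis by (rule Lim_transform_eventually)
qed

lemma infinitesimal: "padic_infinitesimal p M K X"
  unfolding padic_infinitesimal_def
proof (intro ballI impI)
  fix U assume U: "U \<in> sets B" "\<exists>W. openin T W \<and> padic_zero \<in> W \<and> W \<subseteq> U"
  then obtain r where r: "C r (V r padic_zero) \<subseteq> U"
    unfolding openin_padic_iff by blast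
  \<comment> \<open>One level finer than necessary, because hypothesis (i) concerns levels of the
    form \<open>Suc d\<close>.\<close>
  then have sub: "\<Delta> - U \<subseteq> \<Delta> - C (Suc r) 0"
    using cyl_mono[OF zero_in_padic_set, of r "Suc r"] by auto
  have bounds: "0 \<le> (MAX k\<in>{1..K n}. measure (M n) {\<omega> \<in> space (M n). X n k \<omega> \<in> \<Delta> - U})"
    "(MAX k\<in>{1..K n}. measure (M n) {\<omega> \<in> space (M n). X n k \<omega> \<in> \<Delta> - U})
      \<le> (MAX k\<in>{1..K n}. measure (\<mu> n k) (\<Delta> - C (Suc r) 0))" if n: "n \<ge> 1" for n
  proof -
    \<comment> \<open>The maximum of an empty set has no specified value, so these bounds rest on
      rows being nonempty.\<close>
    have ne: "{1..K n} \<noteq> {}" using K_pos[OF n] by simp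
    then show "0 \<le> (MAX k\<in>{1..K n}. measure (M n) {\<omega> \<in> space (M n). X n k \<omega> \<in> \<Delta> - U})"
      by (subst Max_ge_iff) auto
    have *: "measure (M n) {\<omega> \<in> space (M n). X n k \<omega> \<in> \<Delta> - U} \<le> measure (\<mu> n k) (\<Delta> - C (Suc r) 0)"
      if k: "k \<in> {1..K n}" for k
    proof -
      interpret prob_space "\<mu> n k" using prob_\<mu>[OF n k] .
      have "\<Delta> - U \<in> sets B" "\<Delta> - C (Suc r) 0 \<in> sets B"
        using sets.compl_sets[OF U(1)] sets.compl_sets[OF cyl_sets[of "Suc r" 0]] by simp_all
      then show ?thesis
        using sub by (subst measure_\<mu>[OF n k, symmetric]) (auto simp: sets_\<mu> intro!: finite_measure_mono)
    qed
    show "(MAX k\<in>{1..K n}. measure (M n) {\<omega> \<in> space (M n). X n k \<omega> \<in> \<Delta> - U})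
        \<le> (MAX k\<in>{1..K n}. measure (\<mu> n k) (\<Delta> - C (Suc r) 0))"
    proof (rule Max.boundedI)
      fix y assume "y \<in> (\<lambda>k. measure (M n) {\<omega> \<in> space (M n). X n k \<omega> \<in> \<Delta> - U}) ` {1..K n}"
      then obtain k where k: "k \<in> {1..K n}"
        and y: "y = measure (M n) {\<omega> \<in> space (M n). X n k \<omega> \<in> \<Delta> - U}" by blast
      have "measure (\<mu> n k) (\<Delta> - C (Suc r) 0) \<le> (MAX k\<in>{1..K n}. measure (\<mu> n k) (\<Delta> - C (Suc r) 0))"
        using k by (intro Max_ge imageI) auto
      then show "y \<le> (MAX k\<in>{1..K n}. measure (\<mu> n k) (\<Delta> - C (Suc r) 0))"
        using *[OF k] y by linarith
    qed (use ne in auto)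
  qed
  show "(\<lambda>n. MAX k\<in>{1..K n}. measure (M n) {\<omega> \<in> space (M n). X n k \<omega> \<in> \<Delta> - U}) \<longlonglongrightarrow> 0"
    by (rule tendsto_sandwich[OF _ _ tendsto_const max_tendsto[of r]])
      (use bounds in \<open>auto intro!: eventually_sequentiallyI[of 1]\<close>)
qed

section \<open>Characteristic functions of the row sums\<close>

lemma integral_character_sum:
  assumes "padic_character p \<psi>" "n \<ge> 1"
  shows "(\<integral>x. \<psi> x \<partial>distr (M n) B (\<lambda>\<omega>. \<Otimes>\<^bsub>G\<^esub>k\<in>{1..K n}. X n k \<omega>))
    = (\<Prod>k=1..K n. \<integral>x. \<psi> x \<partial>\<mu> n k)"
proof -
  interpret prob_space "M n" by (rule prob_M) fact
  note \<psi> = character_measurable[OF assms(1)]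
  have "(\<integral>x. \<psi> x \<partial>distr (M n) B (\<lambda>\<omega>. \<Otimes>\<^bsub>G\<^esub>k\<in>{1..K n}. X n k \<omega>))
      = (\<integral>\<omega>. \<psi> (\<Otimes>\<^bsub>G\<^esub>k\<in>{1..K n}. X n k \<omega>) \<partial>M n)"
    using assms(2) X_meas \<psi> by (intro integral_distr finprod_measurable) auto
  also have "\<dots> = (\<integral>\<omega>. (\<Prod>k=1..K n. \<psi> (X n k \<omega>)) \<partial>M n)"
    using X_in[OF assms(2)]
    by (intro Bochner_Integration.integral_cong refl character_finprod assms) auto
  also have "\<dots> = (\<Prod>k=1..K n. \<integral>\<omega>. \<psi> (X n k \<omega>) \<partial>M n)"
  proof (rule indep_vars_lebesgue_integral)
    show "indep_vars (\<lambda>_. borel) (\<lambda>k \<omega>. \<psi> (X n k \<omega>)) {1..K n}"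
      using X_indep[OF assms(2)] \<psi> by (rule indep_vars_compose2)
    show "integrable (M n) (\<lambda>\<omega>. \<psi> (X n k \<omega>))" if k: "k \<in> {1..K n}" for k
      using character_integrable[OF prob_\<mu>[OF assms(2) k] sets_\<mu> assms(1)]
      unfolding \<mu>_def by (rule integrable_distr[OF X_meas[OF assms(2) k]])
  qed auto
  also have "\<dots> = (\<Prod>k=1..K n. \<integral>x. \<psi> x \<partial>\<mu> n k)"
    unfolding \<mu>_def using X_meas[OF assms(2)] \<psi> by (intro prod.cong refl integral_distr[symmetric])
  finally show ?thesis .
qed

lemma character_tendsto:
  assumes \<psi>: "padic_character p \<psi>"
  shows "(\<lambda>n. \<integral>x. \<psi> x \<partial>distr (M n) B (\<lambda>\<omega>. \<Otimes>\<^bsub>G\<^esub>k\<in>{1..K n}. X n k \<omega>))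
    \<longlonglongrightarrow> exp (\<integral>x. (\<psi> x - 1) \<partial>\<eta>)"
proof -
  obtain d where d: "\<And>x. x \<in> \<Delta> \<Longrightarrow> \<psi> x = \<psi> (padic_digits p (V (Suc d) x))"
    using character_eq_val[OF \<psi>] by blast
  let ?r = "Suc d"
  define h where "h a = \<psi> (padic_digits p a) - 1" for a
  have h_norm: "cmod (h a) \<le> 2" for a
  proof -
    have "cmod (\<psi> (padic_digits p a)) = 1"
      using \<psi> by (simp add: padic_character_def)
    then show ?thesis
      unfolding h_def using norm_triangle_ineq4[of "\<psi> (padic_digits p a)" 1] by simp
  qed
  have "padic_digits p 0 = padic_zero"
    by (simp add: padic_digits_def padic_zero_def fun_eq_iff)
  then have h_0: "h 0 = 0"
    by (simp add: h_def character_zero[OF \<psi>])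
  \<comment> \<open>Stated so as to fit both the laws of the entries and \<eta>. If class 0 has
    infinite mass, \<open>measure\<close> takes its default value 0 there; the factor
    \<open>h 0 = 0\<close> makes this immaterial.\<close>
  have integral_h: "(\<integral>x. (\<psi> x - 1) \<partial>\<nu>) = (\<Sum>a<p ^ ?r. measure \<nu> (C ?r a) *\<^sub>R h a)"
    if "sets \<nu> = sets B" "\<And>a. a \<noteq> 0 \<Longrightarrow> emeasure \<nu> (C ?r a) < \<infinity>" for \<nu>
  proof -
    have "(\<integral>x. (\<psi> x - 1) \<partial>\<nu>) = (\<integral>x. h (V ?r x) \<partial>\<nu>)"
      using sets_eq_imp_space_eq[OF that(1)]
      by (intro Bochner_Integration.integral_cong refl) (simp add: h_def flip: d)
    also have "\<dots> = (\<Sum>a<p ^ ?r. measure \<nu> (C ?r a) *\<^sub>R h a)"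
      using that h_0 by (intro has_bochner_integral_integral_eq has_integral_val) metis+
    finally show ?thesis .
  qed
  define c where "c n k = (\<integral>x. (\<psi> x - 1) \<partial>\<mu> n k)" for n k
  \<comment> \<open>The probability of a nonzero residue. As |\<psi> - 1| is at most 2 and vanishes
    on class 0, 2t bounds |c|; hypothesis (i) controls the maximum of t over a row, hypothesis (ii)
    its sum.\<close>
  define t where "t n k = measure (\<mu> n k) (\<Delta> - C ?r 0)" for n k
  have c_eq: "c n k = (\<Sum>a<p ^ ?r. measure (\<mu> n k) (C ?r a) *\<^sub>R h a)"
    and c_add_1: "1 + c n k = (\<integral>x. \<psi> x \<partial>\<mu> n k)"
    and c_norm: "cmod (1 + c n k) \<le> 1"
    and t_eq: "t n k = (\<Sum>a\<in>{0<..<p ^ ?r}. measure (\<mu> n k) (C ?r a))"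
    and c_le: "cmod (c n k) \<le> 2 * t n k"
    if n: "n \<ge> 1" and k: "k \<in> {1..K n}" for n k
  proof -
    interpret prob_space "\<mu> n k" using prob_\<mu>[OF n k] .
    show c: "c n k = (\<Sum>a<p ^ ?r. measure (\<mu> n k) (C ?r a) *\<^sub>R h a)"
      unfolding c_def by (intro integral_h) (auto simp: sets_\<mu> less_top[symmetric])
    have int: "integrable (\<mu> n k) \<psi>"
      using character_integrable[OF prob_\<mu>[OF n k] sets_\<mu> \<psi>] .
    then show 1: "1 + c n k = (\<integral>x. \<psi> x \<partial>\<mu> n k)"
      by (simp add: c_def prob_space)
    have "cmod (\<integral>x. \<psi> x \<partial>\<mu> n k) \<le> (\<integral>x. cmod (\<psi> x) \<partial>\<mu> n k)"
      by (rule integral_norm_bound)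
    also have "\<dots> = (\<integral>x. 1 \<partial>\<mu> n k)"
      using \<psi> sets_eq_imp_space_eq[OF sets_\<mu>[of n k]]
      by (intro Bochner_Integration.integral_cong refl) (simp add: padic_character_def)
    finally show "cmod (1 + c n k) \<le> 1" by (simp add: 1 prob_space)
    have "\<Delta> - C ?r 0 = (\<Union>a\<in>{0<..<p ^ ?r}. C ?r a)"
      using val_less[of _ ?r] by (auto simp: padic_cyl_def)
    moreover have "measure (\<mu> n k) (\<Union>a\<in>{0<..<p ^ ?r}. C ?r a)
        = (\<Sum>a\<in>{0<..<p ^ ?r}. measure (\<mu> n k) (C ?r a))"
    proof (rule finite_measure_finite_Union)
      show "C ?r ` {0<..<p ^ ?r} \<subseteq> events"
        using cyl_sets by (auto simp: sets_\<mu>)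
      show "disjoint_family_on (C ?r) {0<..<p ^ ?r}"
        by (auto simp: disjoint_family_on_def padic_cyl_def)
    qed auto
    ultimately show t: "t n k = (\<Sum>a\<in>{0<..<p ^ ?r}. measure (\<mu> n k) (C ?r a))"
      by (simp add: t_def)
    have "c n k = (\<Sum>a\<in>{0<..<p ^ ?r}. measure (\<mu> n k) (C ?r a) *\<^sub>R h a)"
      unfolding c by (rule sum.mono_neutral_right) (auto simp: h_0)
    moreover have "cmod (\<Sum>a\<in>{0<..<p ^ ?r}. measure (\<mu> n k) (C ?r a) *\<^sub>R h a)
        \<le> (\<Sum>a\<in>{0<..<p ^ ?r}. measure (\<mu> n k) (C ?r a) * 2)"
      using h_norm by (intro sum_norm_le) (auto intro: mult_left_mono)
    ultimately show "cmod (c n k) \<le> 2 * t n k"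
      by (simp add: t sum_distrib_left mult.commute)
  qed
  have "(\<lambda>n. \<Prod>k\<in>{1..K n}. 1 + c n k) \<longlonglongrightarrow> exp (\<integral>x. (\<psi> x - 1) \<partial>\<eta>)"
  proof (rule prod_tendsto_exp)
    show "finite {1..K n}" for n by simp
    show "\<forall>\<^sub>F n in sequentially. \<forall>k\<in>{1..K n}. cmod (1 + c n k) \<le> 1 \<and>
        cmod (c n k) \<le> 2 * (MAX k\<in>{1..K n}. t n k)"
      using eventually_ge_at_top[of 1]
    proof eventually_elim
      case (elim n)
      show ?case
      proof
        fix k assume k: "k \<in> {1..K n}"
        then have "t n k \<le> (MAX k\<in>{1..K n}. t n k)"
          by (intro Max_ge imageI) auto
        then show "cmod (1 + c n k) \<le> 1 \<and> cmod (c n k) \<le> 2 * (MAX k\<in>{1..K n}. t n k)"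
          using c_norm[OF elim k] c_le[OF elim k] by linarith
      qed
    qed
    show "(\<lambda>n. 2 * (MAX k\<in>{1..K n}. t n k)) \<longlonglongrightarrow> 0"
      using tendsto_mult_right_zero[OF max_tendsto[of d], of 2] by (simp add: t_def)
    have "(\<lambda>n. \<Sum>a\<in>{0<..<p ^ ?r}. \<Sum>k=1..K n. measure (\<mu> n k) (C ?r a))
        \<longlonglongrightarrow> (\<Sum>a\<in>{0<..<p ^ ?r}. measure \<eta> (C ?r a))"
      by (intro tendsto_sum sum_tendsto) auto
    \<comment> \<open>The limit is a finite number; adding 1 is an arbitrary margin that turns
      convergence into an eventual bound.\<close>
    then have "\<forall>\<^sub>F n in sequentially. (\<Sum>a\<in>{0<..<p ^ ?r}. \<Sum>k=1..K n. measure (\<mu> n k) (C ?r a))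
        < (\<Sum>a\<in>{0<..<p ^ ?r}. measure \<eta> (C ?r a)) + 1"
      by (rule order_tendstoD) simp
    then show "\<forall>\<^sub>F n in sequentially. (\<Sum>k\<in>{1..K n}. cmod (c n k))
        \<le> 2 * ((\<Sum>a\<in>{0<..<p ^ ?r}. measure \<eta> (C ?r a)) + 1)"
      using eventually_ge_at_top[of 1]
    proof eventually_elim
      case (elim n)
      have "(\<Sum>k\<in>{1..K n}. cmod (c n k)) \<le> (\<Sum>k\<in>{1..K n}. 2 * t n k)"
        using c_le elim(2) by (intro sum_mono)
      also have "\<dots> = 2 * (\<Sum>a\<in>{0<..<p ^ ?r}. \<Sum>k=1..K n. measure (\<mu> n k) (C ?r a))"
        using t_eq elim(2) by (subst sum.swap) (simp add: sum_distrib_left)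
      also have "\<dots> \<le> 2 * ((\<Sum>a\<in>{0<..<p ^ ?r}. measure \<eta> (C ?r a)) + 1)"
        by (intro mult_left_mono less_imp_le[OF elim(1)]) simp
      finally show ?case .
    qed
    have "(\<lambda>n. \<Sum>a<p ^ ?r. (\<Sum>k=1..K n. measure (\<mu> n k) (C ?r a)) *\<^sub>R h a)
        \<longlonglongrightarrow> (\<Sum>a<p ^ ?r. measure \<eta> (C ?r a) *\<^sub>R h a)"
    proof (rule tendsto_sum)
      \<comment> \<open>Hypothesis (ii) is silent on class 0, where the sums may diverge; that term
        is 0 because \<open>h 0 = 0\<close>.\<close>
      fix a assume "a \<in> {..<p ^ ?r}"
      then show "(\<lambda>n. (\<Sum>k=1..K n. measure (\<mu> n k) (C ?r a)) *\<^sub>R h a)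
          \<longlonglongrightarrow> measure \<eta> (C ?r a) *\<^sub>R h a"
        using sum_tendsto[of a d] by (cases "a = 0") (auto simp: h_0 intro!: tendsto_intros)
    qed
    also have "(\<Sum>a<p ^ ?r. measure \<eta> (C ?r a) *\<^sub>R h a) = (\<integral>x. (\<psi> x - 1) \<partial>\<eta>)"
      by (rule integral_h[symmetric]) (auto simp: sets_\<eta> emeasure_\<eta>_cyl[simplified])
    finally show "(\<lambda>n. \<Sum>k\<in>{1..K n}. c n k) \<longlonglongrightarrow> (\<integral>x. (\<psi> x - 1) \<partial>\<eta>)"
    proof (rule Lim_transform_eventually)
      show "\<forall>\<^sub>F n in sequentially. (\<Sum>a<p ^ ?r. (\<Sum>k=1..K n. measure (\<mu> n k) (C ?r a)) *\<^sub>R h a)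
          = (\<Sum>k\<in>{1..K n}. c n k)"
        using eventually_ge_at_top[of 1]
      proof eventually_elim
        case (elim n)
        have "(\<Sum>k\<in>{1..K n}. c n k) = (\<Sum>k\<in>{1..K n}. \<Sum>a<p ^ ?r. measure (\<mu> n k) (C ?r a) *\<^sub>R h a)"
          using c_eq[OF elim] by (intro sum.cong refl)
        then show ?case by (subst (asm) sum.swap) (simp only: scaleR_left.sum)
      qed
    qed
  qed
  moreover have "\<forall>\<^sub>F n in sequentially. (\<Prod>k\<in>{1..K n}. 1 + c n k)
      = (\<integral>x. \<psi> x \<partial>distr (M n) B (\<lambda>\<omega>. \<Otimes>\<^bsub>G\<^esub>k\<in>{1..K n}. X n k \<omega>))"
    using eventually_ge_at_top[of 1]
  proof eventually_elim
    case (elim n)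
    show ?case
      unfolding integral_character_sum[OF \<psi> elim] using c_add_1[OF elim] by (intro prod.cong refl)
  qed
  ultimately show ?thesis by (rule Lim_transform_eventually)
qed

lemma sum_weakly_converges:
  "weakly_converges T (\<lambda>n. distr (M n) B (\<lambda>\<omega>. \<Otimes>\<^bsub>G\<^esub>k\<in>{1..K n}. X n k \<omega>)) (padic_pi p \<eta>)"
proof -
  let ?S = "\<lambda>n. distr (M n) B (\<lambda>\<omega>. \<Otimes>\<^bsub>G\<^esub>k\<in>{1..K n}. X n k \<omega>)"
  have "prob_space (?S n)" if n: "n \<ge> 1" for n
    using n by (intro prob_space.prob_space_distr prob_M finprod_measurable X_meas) auto
  then have "\<forall>\<^sub>F n in sequentially. prob_space (?S n)"
    by (rule eventually_sequentiallyI)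
  moreover have "sets (?S n) = sets B" for n by simp
  ultimately show ?thesis
    using character_tendsto
  proof (rule weakly_converges_of_characters)
    fix \<pi> assume \<pi>: "prob_space \<pi>" "sets \<pi> = sets B"
      "\<And>\<psi>. padic_character p \<psi> \<Longrightarrow> (\<integral>x. \<psi> x \<partial>\<pi>) = exp (\<integral>x. (\<psi> x - 1) \<partial>\<eta>)"
      and conv: "weakly_converges T ?S \<pi>"
    \<comment> \<open>The limit found through characters witnesses existence in the description, and
      equality of all character integrals gives uniqueness.\<close>
    have "padic_pi p \<eta> = \<pi>"
      unfolding padic_pi_def
    proof (rule the_equality)
      fix \<pi>' assume "prob_space \<pi>' \<and> sets \<pi>' = sets B \<and>
        (\<forall>\<psi>. padic_character p \<psi> \<longrightarrow> (\<integral>x. \<psi> x \<partial>\<pi>') = exp (\<integral>x. (\<psi> x - 1) \<partial>\<eta>))"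
      then show "\<pi>' = \<pi>"
        using \<pi> by (intro measure_eqI_characters) auto
    qed (use \<pi> in auto)
    then show ?thesis using conv by simp
  qed
qed

end

theorem theorem7p1:
  fixes p :: nat
    and M :: "nat \<Rightarrow> 'a measure"
    and K :: "nat \<Rightarrow> nat"
    and X :: "nat \<Rightarrow> nat \<Rightarrow> 'a \<Rightarrow> (nat \<Rightarrow> nat)"
    and \<eta> :: "(nat \<Rightarrow> nat) measure"
  assumes "prime p"
    and "\<And>n. n \<ge> 1 \<Longrightarrow> prob_space (M n)"
    and "\<And>n. n \<ge> 1 \<Longrightarrow> K n \<ge> 1"
    and "\<And>n k. n \<ge> 1 \<Longrightarrow> k \<in> {1..K n} \<Longrightarrow> X n k \<in> measurable (M n) (padic_borel p)"
    and "\<And>n. n \<ge> 1 \<Longrightarrow> prob_space.indep_vars (M n) (\<lambda>_. padic_borel p) (X n) {1..K n}"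
    and "padic_levy_measure p \<eta>"
    and "\<And>d. (\<lambda>n. MAX k\<in>{1..K n}.
            measure (M n) {\<omega> \<in> space (M n). \<exists>j\<le>d. X n k \<omega> j \<noteq> 0}) \<longlonglongrightarrow> 0"
    and "\<And>d (l :: nat \<Rightarrow> nat). (\<forall>j\<le>d. l j \<in> {0..p - 1}) \<Longrightarrow> (\<exists>j\<le>d. l j \<noteq> 0) \<Longrightarrow>
            (\<lambda>n. \<Sum>k=1..K n. measure (M n) {\<omega> \<in> space (M n). \<forall>j\<le>d. X n k \<omega> j = l j})
              \<longlonglongrightarrow> measure \<eta> {x \<in> padic_set p. \<forall>j\<le>d. x j = l j}"
  shows "padic_infinitesimal p M K X \<and>
    weakly_converges (padic_topology p)
      (\<lambda>n. distr (M n) (padic_borel p) (\<lambda>\<omega>. \<Otimes>\<^bsub>padic_group p\<^esub>k\<in>{1..K n}. X n k \<omega>))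
      (padic_pi p \<eta>)"
proof -
  interpret padic_array p M K X \<eta>
    using prime_gt_0_nat[OF assms(1)] assms(2-8)
    by (intro padic_array.intro padic.intro padic_array_axioms.intro)
  show ?thesis
    using infinitesimal sum_weakly_converges by blast
qed

end
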